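(* Let $\mathsf{X}$ be a category with a topological functor $|\text{-}|\colon\mathsf{X}\to\mathsf{Set}$. Then the regular completion $\mathsf{X}_{\mathrm{reg}}$ of $\mathsf{X}$ and the category $\mathrm{PER}(\mathsf{X},\mathrm{RegMono})$ are equivalent.
   Context: A functor $|\text{-}|\colon\mathsf{X}\to\mathsf{Set}$ is topological if every (possibly large) $|\text{-}|$-structured source $(A\to|X_i|)_i$ has a unique $|\text{-}|$-initial lifting; then $|\text{-}|$ is faithful and $\mathsf{X}$ is complete and cocomplete. The regular completion $\mathsf{X}_{\mathrm{reg}}$: objects are morphisms $f\colon X\to Y$ of $\mathsf{X}$; a morphism from $f\colon X\to Y$ to $g\colon Z\to W$ is an equivalence class $[l]$ of $\mathsf{X}$-morphisms $l\colon X\to Z$ such that $g\cdot l\cdot f_0=g\cdot l\cdot f_1$, where $f_0,f_1\colon\mathrm{Ker}(f)\to X$ is the kernel pair of $f$; two such $l,m$ are equivalent iff $g\cdot l=g\cdot m$. Composition is induced from $\mathsf{X}$. A pseudo-equivalence relation on $\mathsf{X}$ is a parallel pair $r_1,r_2\colon X_1\to X_0$ in $\mathsf{X}$ such that: (reflexivity) there is $r\colon X_0\to X_1$ with $r_1\cdot r=1_{X_0}=r_2\cdot r$; (symmetry) there is $s\colon X_1\to X_1$ with $r_1\cdot s=r_2$ and $r_2\cdot s=r_1$; (transitivity) if $r_3,r_4\colon X_2\to X_1$ is a pullback with $r_2\cdot r_3=r_1\cdot r_4$, there is $t\colon X_2\to X_1$ with $r_1\cdot t=r_1\cdot r_3$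 and $r_2\cdot t=r_2\cdot r_4$. $\mathrm{PER}(\mathsf{X},\mathrm{RegMono})$: objects are the pseudo-equivalence relations for which $\langle r_1,r_2\rangle\colon X_1\to X_0\times X_0$ is a regular monomorphism. A morphism from $(r_1,r_2\colon X_1\to X_0)$ to $(s_1,s_2\colon Y_1\to Y_0)$ is an equivalence class $[f]$ of morphisms $f\colon X_0\to Y_0$ for which there exists $g\colon X_1\to Y_1$ with $f\cdot r_i=s_i\cdot g$, $i=1,2$; two such $f_1,f_2$ are equivalent iff there is $h\colon X_0\to Y_1$ with $f_i=s_i\cdot h$, $i=1,2$. (It is a full subcategory of the exact completion $\mathsf{X}_{\mathrm{ex}}$.) *)

theory Defs
  imports Main "HOL-Library.FuncSet"
begin

section \<open>Categories, functors, equivalences\<close>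

record ('o, 'a) cat =
  Obj :: "'o set"
  Arr :: "'a set"
  Dom :: "'a \<Rightarrow> 'o"
  Cod :: "'a \<Rightarrow> 'o"
  Id :: "'o \<Rightarrow> 'a"
  Comp :: "'a \<Rightarrow> 'a \<Rightarrow> 'a" (infixr "\<cdot>\<index>" 70)

definition Hom :: "('o, 'a) cat \<Rightarrow> 'o \<Rightarrow> 'o \<Rightarrow> 'a set" where
  "Hom C A B = {f \<in> Arr C. Dom C f = A \<and> Cod C f = B}"

locale category =
  fixes C :: "('o, 'a) cat" (structure)
  assumes Dom_Obj: "f \<in> Arr C \<Longrightarrow> Dom C f \<in> Obj C"
    and Cod_Obj: "f \<in> Arr C \<Longrightarrow> Cod C f \<in> Obj C"
    and Id_Hom: "A \<in> Obj C \<Longrightarrow> Id C A \<in> Hom C A A"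
    and Comp_Hom: "f \<in> Hom C A B \<Longrightarrow> g \<in> Hom C B D \<Longrightarrow> g \<cdot> f \<in> Hom C A D"
    and Comp_assoc: "f \<in> Hom C A B \<Longrightarrow> g \<in> Hom C B D \<Longrightarrow> h \<in> Hom C D E
          \<Longrightarrow> (h \<cdot> g) \<cdot> f = h \<cdot> (g \<cdot> f)"
    and Comp_Id_right: "f \<in> Hom C A B \<Longrightarrow> f \<cdot> Id C A = f"
    and Comp_Id_left: "f \<in> Hom C A B \<Longrightarrow> Id C B \<cdot> f = f"

record ('o, 'a, 'p, 'b) cat_functor =
  on_obj :: "'o \<Rightarrow> 'p"
  on_arr :: "'a \<Rightarrow> 'b"

definition is_functor ::
  "('o, 'a) cat \<Rightarrow> ('p, 'b) cat \<Rightarrow> ('o, 'a, 'p, 'b) cat_functor \<Rightarrow> bool" where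
  "is_functor C D F \<longleftrightarrow> category C \<and> category D
    \<and> (\<forall>A\<in>Obj C. on_obj F A \<in> Obj D)
    \<and> (\<forall>f\<in>Arr C. on_arr F f \<in> Hom D (on_obj F (Dom C f)) (on_obj F (Cod C f)))
    \<and> (\<forall>A\<in>Obj C. on_arr F (Id C A) = Id D (on_obj F A))
    \<and> (\<forall>f\<in>Arr C. \<forall>g\<in>Arr C. Cod C f = Dom C g \<longrightarrow>
          on_arr F (g \<cdot>\<^bsub>C\<^esub> f) = on_arr F g \<cdot>\<^bsub>D\<^esub> on_arr F f)"

definition id_functor :: "('o, 'a, 'o, 'a) cat_functor" where
  "id_functor = \<lparr>on_obj = (\<lambda>A. A), on_arr = (\<lambda>f. f)\<rparr>"

definition comp_functor ::
  "('p, 'b, 'q, 'c) cat_functor \<Rightarrow> ('o, 'a, 'p, 'b) cat_functor \<Rightarrow> ('o, 'a, 'q, 'c) cat_functor" where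
  "comp_functor G F = \<lparr>on_obj = on_obj G \<circ> on_obj F, on_arr = on_arr G \<circ> on_arr F\<rparr>"

definition is_iso :: "('o, 'a) cat \<Rightarrow> 'a \<Rightarrow> bool" where
  "is_iso C f \<longleftrightarrow> f \<in> Arr C \<and>
    (\<exists>g \<in> Hom C (Cod C f) (Dom C f).
       g \<cdot>\<^bsub>C\<^esub> f = Id C (Dom C f) \<and> f \<cdot>\<^bsub>C\<^esub> g = Id C (Cod C f))"

definition natural_iso :: "('o, 'a) cat \<Rightarrow> ('p, 'b) cat \<Rightarrow>
    ('o, 'a, 'p, 'b) cat_functor \<Rightarrow> ('o, 'a, 'p, 'b) cat_functor \<Rightarrow> ('o \<Rightarrow> 'b) \<Rightarrow> bool" where
  "natural_iso C D F G \<eta> \<longleftrightarrow>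
    (\<forall>A\<in>Obj C. \<eta> A \<in> Hom D (on_obj F A) (on_obj G A) \<and> is_iso D (\<eta> A))
    \<and> (\<forall>f\<in>Arr C. \<eta> (Cod C f) \<cdot>\<^bsub>D\<^esub> on_arr F f = on_arr G f \<cdot>\<^bsub>D\<^esub> \<eta> (Dom C f))"

definition equivalent_categories :: "('o, 'a) cat \<Rightarrow> ('p, 'b) cat \<Rightarrow> bool" where
  "equivalent_categories C D \<longleftrightarrow> category C \<and> category D \<and>
    (\<exists>F G \<eta> \<epsilon>. is_functor C D F \<and> is_functor D C G
       \<and> natural_iso C C id_functor (comp_functor G F) \<eta>
       \<and> natural_iso D D (comp_functor F G) id_functor \<epsilon>)"


section \<open>Finite limits\<close>

definition is_product :: "('o, 'a) cat \<Rightarrow> 'o \<Rightarrow> 'o \<Rightarrow> 'a \<Rightarrow> 'a \<Rightarrow> bool" where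
  "is_product C A B p q \<longleftrightarrow>
    (\<exists>P. p \<in> Hom C P A \<and> q \<in> Hom C P B \<and>
      (\<forall>T. \<forall>u \<in> Hom C T A. \<forall>v \<in> Hom C T B.
         \<exists>!k. k \<in> Hom C T P \<and> p \<cdot>\<^bsub>C\<^esub> k = u \<and> q \<cdot>\<^bsub>C\<^esub> k = v))"

definition is_pullback :: "('o, 'a) cat \<Rightarrow> 'a \<Rightarrow> 'a \<Rightarrow> 'a \<Rightarrow> 'a \<Rightarrow> bool" where
  "is_pullback C f g p q \<longleftrightarrow>
    f \<in> Arr C \<and> g \<in> Arr C \<and> Cod C f = Cod C g \<and>
    (\<exists>P. p \<in> Hom C P (Dom C f) \<and> q \<in> Hom C P (Dom C g) \<and> f \<cdot>\<^bsub>C\<^esub> p = g \<cdot>\<^bsub>C\<^esub> q \<and>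
      (\<forall>T. \<forall>u \<in> Hom C T (Dom C f). \<forall>v \<in> Hom C T (Dom C g). f \<cdot>\<^bsub>C\<^esub> u = g \<cdot>\<^bsub>C\<^esub> v \<longrightarrow>
         (\<exists>!k. k \<in> Hom C T P \<and> p \<cdot>\<^bsub>C\<^esub> k = u \<and> q \<cdot>\<^bsub>C\<^esub> k = v)))"

definition is_kernel_pair :: "('o, 'a) cat \<Rightarrow> 'a \<Rightarrow> 'a \<Rightarrow> 'a \<Rightarrow> bool" where
  "is_kernel_pair C f f0 f1 \<longleftrightarrow> is_pullback C f f f0 f1"

definition is_equalizer :: "('o, 'a) cat \<Rightarrow> 'a \<Rightarrow> 'a \<Rightarrow> 'a \<Rightarrow> bool" where
  "is_equalizer C f g m \<longleftrightarrow>
    f \<in> Arr C \<and> g \<in> Arr C \<and> Dom C f = Dom C g \<and> Cod C f = Cod C g \<and>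
    (\<exists>E. m \<in> Hom C E (Dom C f) \<and> f \<cdot>\<^bsub>C\<^esub> m = g \<cdot>\<^bsub>C\<^esub> m \<and>
      (\<forall>T. \<forall>u \<in> Hom C T (Dom C f). f \<cdot>\<^bsub>C\<^esub> u = g \<cdot>\<^bsub>C\<^esub> u \<longrightarrow>
         (\<exists>!k. k \<in> Hom C T E \<and> m \<cdot>\<^bsub>C\<^esub> k = u)))"

definition RegMono :: "('o, 'a) cat \<Rightarrow> 'a set" where
  "RegMono C = {m. \<exists>f g. is_equalizer C f g m}"


section \<open>The category of sets\<close>

text \<open>
  HOL has no type of all sets, so the category of sets is taken relative to a Grothendieck
  universe, presented by the family of those subsets of a type that count as small.  Since HOL
  sets of type \<open>'u set\<close> are not themselves of type \<open>'u\<close>, the power set of a small set is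
  required to be small up to a bijection.  Infinity is not imposed, so finite
  sets of natural numbers form a universe too.
\<close>

definition set_universe :: "'u set set \<Rightarrow> bool" where
  "set_universe U \<longleftrightarrow>
    {} \<in> U
    \<and> (\<forall>A\<in>U. \<forall>B. B \<subseteq> A \<longrightarrow> B \<in> U)
    \<and> (\<forall>A\<in>U. \<forall>f :: 'u \<Rightarrow> 'u. f ` A \<in> U)
    \<and> (\<forall>I\<in>U. \<forall>A :: 'u \<Rightarrow> 'u set. (\<forall>i\<in>I. A i \<in> U) \<longrightarrow> (\<Union>i\<in>I. A i) \<in> U)
    \<and> (\<forall>A\<in>U. \<exists>p :: 'u set \<Rightarrow> 'u. inj_on p (Pow A) \<and> p ` Pow A \<in> U)"

definition Set_cat :: "'u set set \<Rightarrow> ('u set, 'u set \<times> ('u \<Rightarrow> 'u) \<times> 'u set) cat" where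
  "Set_cat U = \<lparr>
     Obj = U,
     Arr = {(A, f, B). A \<in> U \<and> B \<in> U \<and> f \<in> A \<rightarrow>\<^sub>E B},
     Dom = (\<lambda>(A, f, B). A),
     Cod = (\<lambda>(A, f, B). B),
     Id = (\<lambda>A. (A, restrict (\<lambda>x. x) A, A)),
     Comp = (\<lambda>(B', g, D) (A, f, B). (A, compose A g f, D))\<rparr>"


section \<open>Topological functors\<close>

definition is_structured_source :: "('o, 'a) cat \<Rightarrow> ('p, 'b) cat \<Rightarrow> ('o, 'a, 'p, 'b) cat_functor \<Rightarrow>
    'p \<Rightarrow> 'i set \<Rightarrow> ('i \<Rightarrow> 'o) \<Rightarrow> ('i \<Rightarrow> 'b) \<Rightarrow> bool" where
  "is_structured_source C D F A I X f \<longleftrightarrow>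
    A \<in> Obj D \<and> (\<forall>i\<in>I. X i \<in> Obj C \<and> f i \<in> Hom D A (on_obj F (X i)))"

definition is_lifting :: "('o, 'a) cat \<Rightarrow> ('o, 'a, 'p, 'b) cat_functor \<Rightarrow>
    'p \<Rightarrow> 'i set \<Rightarrow> ('i \<Rightarrow> 'o) \<Rightarrow> ('i \<Rightarrow> 'b) \<Rightarrow> 'o \<Rightarrow> ('i \<Rightarrow> 'a) \<Rightarrow> bool" where
  "is_lifting C F A I X f A' f' \<longleftrightarrow>
    A' \<in> Obj C \<and> on_obj F A' = A \<and>
    (\<forall>i\<in>I. f' i \<in> Hom C A' (X i) \<and> on_arr F (f' i) = f i)"

definition is_initial_source :: "('o, 'a) cat \<Rightarrow> ('p, 'b) cat \<Rightarrow> ('o, 'a, 'p, 'b) cat_functor \<Rightarrow>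
    'o \<Rightarrow> 'i set \<Rightarrow> ('i \<Rightarrow> 'o) \<Rightarrow> ('i \<Rightarrow> 'a) \<Rightarrow> bool" where
  "is_initial_source C D F A I X f \<longleftrightarrow>
    (\<forall>B\<in>Obj C. \<forall>g h. (\<forall>i\<in>I. g i \<in> Hom C B (X i)) \<and> h \<in> Hom D (on_obj F B) (on_obj F A)
        \<and> (\<forall>i\<in>I. on_arr F (g i) = on_arr F (f i) \<cdot>\<^bsub>D\<^esub> h) \<longrightarrow>
      (\<exists>!k. k \<in> Hom C B A \<and> on_arr F k = h \<and> (\<forall>i\<in>I. g i = f i \<cdot>\<^bsub>C\<^esub> k)))"

text \<open>
  A source is a family, possibly with repetitions, indexed by an arbitrary class.  A definition
  cannot quantify over all index types, but the index type below is large enough.  It contains a copy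
  of the arrows of \<open>C\<close>, which makes the usual cardinality argument go through (a non-faithful \<open>F\<close>
  would give an injection of the power set of the arrows into some hom-set), so \<open>F\<close> is faithful;
  and then the initial liftings of a family depend only on the set of pairs \<open>(X i, f i)\<close>, for
  which the index type also has room.  Without repetitions, faithfulness would be lost.
  The extensionality clause merely makes a family on \<open>I\<close> a unique function.
\<close>

definition topological ::
  "('o, 'a) cat \<Rightarrow> ('p, 'b) cat \<Rightarrow> ('o, 'a, 'p, 'b) cat_functor \<Rightarrow> bool" where
  "topological C D F \<longleftrightarrow> is_functor C D F \<and>
    (\<forall>A (I :: ('o \<times> 'a \<times> 'b) set) X f. is_structured_source C D F A I X f \<longrightarrow>
      (\<exists>!(A', f'). f' \<in> extensional I \<and> is_lifting C F A I X f A' f'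
         \<and> is_initial_source C D F A' I X f'))"


section \<open>Categories with equivalence classes as arrows\<close>

text \<open>
  Both categories below have as arrows from \<open>x\<close> to \<open>y\<close> the classes of representatives \<open>H x y\<close>,
  consisting of arrows of \<open>C\<close>, under a relation \<open>E x y\<close>; \<open>u x\<close> is the object of \<open>C\<close> whose
  identity represents the identity of \<open>x\<close>.  An arrow carries its domain and codomain.
\<close>

definition class_cat :: "('o, 'a) cat \<Rightarrow> 'x set \<Rightarrow> ('x \<Rightarrow> 'o) \<Rightarrow> ('x \<Rightarrow> 'x \<Rightarrow> 'a set) \<Rightarrow>
    ('x \<Rightarrow> 'x \<Rightarrow> ('a \<times> 'a) set) \<Rightarrow> ('x, 'x \<times> 'a set \<times> 'x) cat" where
  "class_cat C Ob u H E = \<lparr>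
     Obj = Ob,
     Arr = {(x, L, y). x \<in> Ob \<and> y \<in> Ob \<and> L \<in> H x y // E x y},
     Dom = (\<lambda>(x, L, y). x),
     Cod = (\<lambda>(x, L, y). y),
     Id = (\<lambda>x. (x, E x x `` {Id C (u x)}, x)),
     Comp = (\<lambda>(y', M, z) (x, L, y). (x, (\<Union>m\<in>M. \<Union>l\<in>L. E x z `` {m \<cdot>\<^bsub>C\<^esub> l}), z))\<rparr>"


subsection \<open>The regular completion\<close>

definition reg_hom :: "('o, 'a) cat \<Rightarrow> 'a \<Rightarrow> 'a \<Rightarrow> 'a set" where
  "reg_hom C f g = {l \<in> Hom C (Dom C f) (Dom C g).
     \<exists>f0 f1. is_kernel_pair C f f0 f1 \<and> g \<cdot>\<^bsub>C\<^esub> l \<cdot>\<^bsub>C\<^esub> f0 = g \<cdot>\<^bsub>C\<^esub> l \<cdot>\<^bsub>C\<^esub> f1}"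

definition reg_rel :: "('o, 'a) cat \<Rightarrow> 'a \<Rightarrow> 'a \<Rightarrow> ('a \<times> 'a) set" where
  "reg_rel C f g = {(l, m). l \<in> reg_hom C f g \<and> m \<in> reg_hom C f g \<and> g \<cdot>\<^bsub>C\<^esub> l = g \<cdot>\<^bsub>C\<^esub> m}"

definition regular_completion :: "('o, 'a) cat \<Rightarrow> ('a, 'a \<times> 'a set \<times> 'a) cat" where
  "regular_completion C = class_cat C (Arr C) (Dom C) (reg_hom C) (reg_rel C)"


subsection \<open>Pseudo-equivalence relations\<close>

definition pseudo_equiv_rel :: "('o, 'a) cat \<Rightarrow> 'a \<times> 'a \<Rightarrow> bool" where
  "pseudo_equiv_rel C = (\<lambda>(r1, r2). \<exists>X1 X0.
     r1 \<in> Hom C X1 X0 \<and> r2 \<in> Hom C X1 X0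
     \<and> (\<exists>r \<in> Hom C X0 X1. r1 \<cdot>\<^bsub>C\<^esub> r = Id C X0 \<and> r2 \<cdot>\<^bsub>C\<^esub> r = Id C X0)
     \<and> (\<exists>s \<in> Hom C X1 X1. r1 \<cdot>\<^bsub>C\<^esub> s = r2 \<and> r2 \<cdot>\<^bsub>C\<^esub> s = r1)
     \<and> (\<forall>r3 r4. is_pullback C r2 r1 r3 r4 \<longrightarrow>
          (\<exists>t \<in> Hom C (Dom C r3) X1.
             r1 \<cdot>\<^bsub>C\<^esub> t = r1 \<cdot>\<^bsub>C\<^esub> r3 \<and> r2 \<cdot>\<^bsub>C\<^esub> t = r2 \<cdot>\<^bsub>C\<^esub> r4)))"

definition PER_obj :: "('o, 'a) cat \<Rightarrow> 'a set \<Rightarrow> ('a \<times> 'a) set" where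
  "PER_obj C M = {(r1, r2). pseudo_equiv_rel C (r1, r2) \<and>
     (\<exists>p q m. is_product C (Cod C r1) (Cod C r1) p q \<and> m \<in> Hom C (Dom C r1) (Dom C p)
        \<and> p \<cdot>\<^bsub>C\<^esub> m = r1 \<and> q \<cdot>\<^bsub>C\<^esub> m = r2 \<and> m \<in> M)}"

definition PER_hom :: "('o, 'a) cat \<Rightarrow> 'a \<times> 'a \<Rightarrow> 'a \<times> 'a \<Rightarrow> 'a set" where
  "PER_hom C = (\<lambda>(r1, r2) (s1, s2). {f \<in> Hom C (Cod C r1) (Cod C s1).
     \<exists>g \<in> Hom C (Dom C r1) (Dom C s1). f \<cdot>\<^bsub>C\<^esub> r1 = s1 \<cdot>\<^bsub>C\<^esub> g \<and> f \<cdot>\<^bsub>C\<^esub> r2 = s2 \<cdot>\<^bsub>C\<^esub> g})"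

definition PER_rel :: "('o, 'a) cat \<Rightarrow> 'a \<times> 'a \<Rightarrow> 'a \<times> 'a \<Rightarrow> ('a \<times> 'a) set" where
  "PER_rel C = (\<lambda>(r1, r2) (s1, s2). {(f1, f2).
     f1 \<in> PER_hom C (r1, r2) (s1, s2) \<and> f2 \<in> PER_hom C (r1, r2) (s1, s2) \<and>
     (\<exists>h \<in> Hom C (Cod C r1) (Dom C s1). f1 = s1 \<cdot>\<^bsub>C\<^esub> h \<and> f2 = s2 \<cdot>\<^bsub>C\<^esub> h)})"

definition PER :: "('o, 'a) cat \<Rightarrow> 'a set \<Rightarrow>
    ('a \<times> 'a, ('a \<times> 'a) \<times> 'a set \<times> ('a \<times> 'a)) cat" where
  "PER C M = class_cat C (PER_obj C M) (\<lambda>(r1, r2). Cod C r1) (PER_hom C) (PER_rel C)"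

end

theory Submission imports Defs begin

text \<open>
  Send an object \<open>f\<close> of the regular completion to its kernel pair \<open>(r1, r2)\<close>.  If \<open>(s1, s2)\<close> is the
  kernel pair of \<open>g\<close>, the condition \<open>g \<cdot> l \<cdot> r1 = g \<cdot> l \<cdot> r2\<close> says, by the universal property of
  \<open>(s1, s2)\<close>, exactly that \<open>l\<close> extends to a morphism \<open>(r1, r2) \<rightarrow> (s1, s2)\<close>, and \<open>g \<cdot> l = g \<cdot> m\<close> says
  exactly that \<open>(l, m)\<close> factors through \<open>(s1, s2)\<close>.  So both categories have literally the same
  classes of arrows as hom-sets (\<open>reg_hom_eq_PER_hom\<close>, \<open>reg_rel_eq_PER_rel\<close>), and the assignment is
  fully faithful for trivial reasons.  A kernel pair is a pseudo-equivalence relation, and it is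
  embedded in the product by a regular monomorphism, namely the equalizer of \<open>f \<cdot> p\<close> and \<open>f \<cdot> q\<close>
  (\<open>kernel_pair_PER\<close>).

  What remains is that every pseudo-equivalence relation \<open>(r1, r2)\<close> on \<open>X0\<close> whose pairing is a
  regular monomorphism is a kernel pair (\<open>PER_is_kernel_pair\<close>).  The pairs of points that it relates
  form an equivalence relation on the underlying set of \<open>X0\<close> (\<open>equiv_point_rel\<close>).  Take a function
  whose fibres are the classes, and regard it as a morphism \<open>f\<close> into an indiscrete object.  If
  \<open>f \<cdot> u = f \<cdot> v\<close>, then pointwise the pairing of \<open>u\<close> and \<open>v\<close> lies in the image of the regular
  monomorphism, so by faithfulness it equalizes the two morphisms of which that monomorphism is an
  equalizer, and therefore factors through it.

  The topological functor enters through four consequences of the existence of initial liftings: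
  it is faithful, it has indiscrete objects, there is an object with one point from which every
  point of every object is the image of a morphism (so that points can be handled by universal
  properties), and products and equalizers are computed on underlying sets.
\<close>

section \<open>Categories whose arrows are classes\<close>

lemma HomI: "f \<in> Arr C \<Longrightarrow> f \<in> Hom C (Dom C f) (Cod C f)"
  by (simp add: Hom_def)

lemma HomD: "f \<in> Hom C A B \<Longrightarrow> f \<in> Arr C \<and> Dom C f = A \<and> Cod C f = B"
  by (simp add: Hom_def)

lemma (in category) Hom_Obj: "f \<in> Hom C A B \<Longrightarrow> A \<in> Obj C \<and> B \<in> Obj C"
  using Dom_Obj Cod_Obj by (auto simp: Hom_def)

lemma (in category) Comp_assoc_last:
  assumes "e \<in> Hom C A B" "f \<in> Hom C B D" "g \<in> Hom C D K" "h \<in> Hom C K L"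
  shows "h \<cdot> g \<cdot> f \<cdot> e = (h \<cdot> g \<cdot> f) \<cdot> e"
  using Comp_assoc[OF assms(1,2,3)] Comp_assoc[OF assms(1) Comp_Hom[OF assms(2,3)] assms(4)] by simp

text \<open>
  The data from which \<open>class_cat\<close> builds a category: \<open>H\<close> is a category on \<open>Ob\<close> whose composition and
  identities are those of \<open>C\<close>, and \<open>E\<close> is a congruence on it.
\<close>

locale hom_congruence = category C for C :: "('o, 'a) cat" (structure) +
  fixes Ob :: "'x set" and u :: "'x \<Rightarrow> 'o"
    and H :: "'x \<Rightarrow> 'x \<Rightarrow> 'a set" and E :: "'x \<Rightarrow> 'x \<Rightarrow> ('a \<times> 'a) set"
  assumes u_Obj: "x \<in> Ob \<Longrightarrow> u x \<in> Obj C"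
    and H_Hom: "x \<in> Ob \<Longrightarrow> y \<in> Ob \<Longrightarrow> H x y \<subseteq> Hom C (u x) (u y)"
    and E_equiv: "x \<in> Ob \<Longrightarrow> y \<in> Ob \<Longrightarrow> equiv (H x y) (E x y)"
    and H_Id: "x \<in> Ob \<Longrightarrow> Id C (u x) \<in> H x x"
    and H_Comp: "x \<in> Ob \<Longrightarrow> y \<in> Ob \<Longrightarrow> z \<in> Ob \<Longrightarrow> l \<in> H x y \<Longrightarrow> m \<in> H y z \<Longrightarrow> m \<cdot> l \<in> H x z"
    and E_Comp: "x \<in> Ob \<Longrightarrow> y \<in> Ob \<Longrightarrow> z \<in> Ob \<Longrightarrow> (l, l') \<in> E x y \<Longrightarrow> (m, m') \<in> E y z
                   \<Longrightarrow> (m \<cdot> l, m' \<cdot> l') \<in> E x z"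
begin

abbreviation "Cls \<equiv> class_cat C Ob u H E"

abbreviation cls :: "'x \<Rightarrow> 'x \<Rightarrow> 'a \<Rightarrow> 'x \<times> 'a set \<times> 'x" where
  "cls x y l \<equiv> (x, E x y `` {l}, y)"

lemma cls_Hom: "x \<in> Ob \<Longrightarrow> y \<in> Ob \<Longrightarrow> l \<in> H x y \<Longrightarrow> cls x y l \<in> Hom Cls x y"
  by (auto simp: Hom_def class_cat_def intro: quotientI)

lemma Cls_HomE:
  assumes "f \<in> Hom Cls x y"
  obtains l where "x \<in> Ob" "y \<in> Ob" "l \<in> H x y" "f = cls x y l"
  using assms by (auto simp: Hom_def class_cat_def elim!: quotientE)

lemma Cls_ArrE:
  assumes "f \<in> Arr Cls"
  obtains x y l where "x \<in> Ob" "y \<in> Ob" "l \<in> H x y" "f = cls x y l"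
  using Cls_HomE[OF HomI[OF assms]] by metis

lemma Cls_Id: "Id Cls x = cls x x (Id C (u x))"
  by (simp add: class_cat_def)

lemma cls_Comp:
  assumes o: "x \<in> Ob" "y \<in> Ob" "z \<in> Ob" and l: "l \<in> H x y" and m: "m \<in> H y z"
  shows "cls y z m \<cdot>\<^bsub>Cls\<^esub> cls x y l = cls x z (m \<cdot> l)"
proof -
  have "E x z `` {m' \<cdot> l'} = E x z `` {m \<cdot> l}" if "m' \<in> E y z `` {m}" "l' \<in> E x y `` {l}" for m' l'
    using that E_Comp[OF o, of l l' m m'] equiv_class_eq[OF E_equiv[OF o(1) o(3)]] by auto
  moreover have "m \<in> E y z `` {m}" "l \<in> E x y `` {l}"
    using l m o E_equiv equiv_class_self by metis+
  ultimately have "(\<Union>m'\<in>E y z `` {m}. \<Union>l'\<in>E x y `` {l}. E x z `` {m' \<cdot> l'}) = E x z `` {m \<cdot> l}"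
    by blast
  then show ?thesis by (simp add: class_cat_def)
qed

lemma category_Cls: "category Cls"
proof
  fix f assume "f \<in> Arr Cls"
  then show "Dom Cls f \<in> Obj Cls" "Cod Cls f \<in> Obj Cls" by (auto simp: class_cat_def)
next
  fix A assume "A \<in> Obj Cls"
  then show "Id Cls A \<in> Hom Cls A A"
    using cls_Hom[of A A] H_Id[of A] by (simp add: class_cat_def)
next
  fix f A B g D assume f: "f \<in> Hom Cls A B" and g: "g \<in> Hom Cls B D"
  obtain l where f: "A \<in> Ob" "B \<in> Ob" "l \<in> H A B" "f = cls A B l" using f by (rule Cls_HomE)
  obtain m where g: "D \<in> Ob" "m \<in> H B D" "g = cls B D m" using g by (rule Cls_HomE)
  show "g \<cdot>\<^bsub>Cls\<^esub> f \<in> Hom Cls A D"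
    unfolding f(4) g(3) cls_Comp[OF f(1,2) g(1) f(3) g(2)]
    using f g by (intro cls_Hom H_Comp[of A B D]) auto
next
  fix f A B g D h K assume f: "f \<in> Hom Cls A B" and g: "g \<in> Hom Cls B D" and h: "h \<in> Hom Cls D K"
  obtain l where f: "A \<in> Ob" "B \<in> Ob" "l \<in> H A B" "f = cls A B l" using f by (rule Cls_HomE)
  obtain m where g: "D \<in> Ob" "m \<in> H B D" "g = cls B D m" using g by (rule Cls_HomE)
  obtain n where h: "K \<in> Ob" "n \<in> H D K" "h = cls D K n" using h by (rule Cls_HomE)
  have "l \<in> Hom C (u A) (u B)" "m \<in> Hom C (u B) (u D)" "n \<in> Hom C (u D) (u K)"
    using f g h H_Hom by blast+
  then have "(n \<cdot> m) \<cdot> l = n \<cdot> m \<cdot> l" by (rule Comp_assoc)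
  moreover have "m \<cdot> l \<in> H A D" "n \<cdot> m \<in> H B K"
    using H_Comp[of A B D l m] H_Comp[of B D K m n] f g h by blast+
  ultimately show "(h \<cdot>\<^bsub>Cls\<^esub> g) \<cdot>\<^bsub>Cls\<^esub> f = h \<cdot>\<^bsub>Cls\<^esub> (g \<cdot>\<^bsub>Cls\<^esub> f)"
    using f g h by (simp add: cls_Comp)
next
  fix f A B assume f: "f \<in> Hom Cls A B"
  obtain l where *: "A \<in> Ob" "B \<in> Ob" "l \<in> H A B" "f = cls A B l"
    using f by (rule Cls_HomE)
  have "l \<in> Hom C (u A) (u B)" using * H_Hom by blast
  then have "l \<cdot> Id C (u A) = l" "Id C (u B) \<cdot> l = l" by (rule Comp_Id_right Comp_Id_left)+
  then show "f \<cdot>\<^bsub>Cls\<^esub> Id Cls A = f" "Id Cls B \<cdot>\<^bsub>Cls\<^esub> f = f"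
    unfolding Cls_Id using * by (simp_all add: cls_Comp H_Id)
qed

end

text \<open>
  An arrow of a class category is a class of arrows of \<open>C\<close> tagged with its domain and codomain.
  When the classes agree, a functor between two such categories only has to change the tags.
\<close>

definition relabel :: "('x \<Rightarrow> 'y) \<Rightarrow> ('x, 'x \<times> 'a set \<times> 'x, 'y, 'y \<times> 'a set \<times> 'y) cat_functor" where
  "relabel K = \<lparr>on_obj = K, on_arr = (\<lambda>(x, L, y). (K x, L, K y))\<rparr>"

lemma comp_relabel: "comp_functor (relabel Q) (relabel K) = relabel (\<lambda>x. Q (K x))"
  by (auto simp: comp_functor_def relabel_def fun_eq_iff)

lemma id_relabel: "id_functor = relabel (\<lambda>x. x)"
  by (auto simp: id_functor_def relabel_def fun_eq_iff)

lemma is_functor_relabel: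
  assumes "hom_congruence C Ob u H E" and "hom_congruence C Ob' u' H' E'"
    and K: "\<And>x. x \<in> Ob \<Longrightarrow> K x \<in> Ob'" "\<And>x. x \<in> Ob \<Longrightarrow> u' (K x) = u x"
    and HE: "\<And>x y. x \<in> Ob \<Longrightarrow> y \<in> Ob \<Longrightarrow> H' (K x) (K y) = H x y \<and> E' (K x) (K y) = E x y"
  shows "is_functor (class_cat C Ob u H E) (class_cat C Ob' u' H' E') (relabel K)"
proof -
  interpret S: hom_congruence C Ob u H E by fact
  interpret T: hom_congruence C Ob' u' H' E' by fact
  have arr: "on_arr (relabel K) (S.cls x y l) = T.cls (K x) (K y) l" if "x \<in> Ob" "y \<in> Ob" for x y l
    using HE that by (simp add: relabel_def)
  show ?thesis unfolding is_functor_def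
  proof (intro conjI ballI impI)
    show "category S.Cls" "category T.Cls" by (rule S.category_Cls T.category_Cls)+
  next
    fix x assume "x \<in> Obj S.Cls"
    then have x: "x \<in> Ob" by (simp add: class_cat_def)
    then show "on_obj (relabel K) x \<in> Obj T.Cls" using K by (simp add: relabel_def class_cat_def)
    show "on_arr (relabel K) (Id S.Cls x) = Id T.Cls (on_obj (relabel K) x)"
      unfolding S.Cls_Id T.Cls_Id arr[OF x x] using K x by (simp add: relabel_def)
  next
    fix f assume "f \<in> Arr S.Cls"
    then obtain x y l where *: "x \<in> Ob" "y \<in> Ob" "l \<in> H x y" "f = S.cls x y l" by (rule S.Cls_ArrE)
    have "T.cls (K x) (K y) l \<in> Hom T.Cls (K x) (K y)" using * HE K by (intro T.cls_Hom) auto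
    then show "on_arr (relabel K) f \<in> Hom T.Cls (on_obj (relabel K) (Dom S.Cls f)) (on_obj (relabel K) (Cod S.Cls f))"
      using * arr HomD[OF S.cls_Hom[OF *(1-3)]] by (simp add: relabel_def)
  next
    fix f g assume f: "f \<in> Arr S.Cls" and g: "g \<in> Arr S.Cls" and fg: "Cod S.Cls f = Dom S.Cls g"
    obtain x y l where *: "x \<in> Ob" "y \<in> Ob" "l \<in> H x y" "f = S.cls x y l" using f by (rule S.Cls_ArrE)
    obtain y' z m where **: "y' \<in> Ob" "z \<in> Ob" "m \<in> H y' z" "g = S.cls y' z m" using g by (rule S.Cls_ArrE)
    have "y' = y" using fg HomD[OF S.cls_Hom[OF *(1-3)]] HomD[OF S.cls_Hom[OF **(1-3)]] * ** by simp
    note ** = **[unfolded this]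
    have "T.cls (K y) (K z) m \<cdot>\<^bsub>T.Cls\<^esub> T.cls (K x) (K y) l = T.cls (K x) (K z) (m \<cdot>\<^bsub>C\<^esub> l)"
      using * ** K(1) HE by (intro T.cls_Comp) auto
    then show "on_arr (relabel K) (g \<cdot>\<^bsub>S.Cls\<^esub> f) = on_arr (relabel K) g \<cdot>\<^bsub>T.Cls\<^esub> on_arr (relabel K) f"
      unfolding *(4) **(4) S.cls_Comp[OF *(1,2) **(2) *(3) **(3)]
        arr[OF *(1,2)] arr[OF **(1,2)] arr[OF *(1) **(2)] by simp
  qed
qed

context hom_congruence begin

text \<open>
  If replacing \<open>x\<close> by \<open>\<phi> x\<close> or \<open>\<psi> x\<close> changes neither the hom-sets nor the congruence, then the class
  of the identity of \<open>u x\<close> is at once an arrow \<open>\<phi> x \<rightarrow> \<psi> x\<close> and an arrow \<open>\<psi> x \<rightarrow> \<phi> x\<close>, and these are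
  mutually inverse.
\<close>

lemma natural_iso_relabel:
  assumes same: "\<And>x y a b. x \<in> Ob \<Longrightarrow> y \<in> Ob \<Longrightarrow> a \<in> {\<phi> x, \<psi> x} \<Longrightarrow> b \<in> {\<phi> y, \<psi> y}
      \<Longrightarrow> a \<in> Ob \<and> u a = u x \<and> H a b = H x y \<and> E a b = E x y"
  shows "natural_iso Cls Cls (relabel \<phi>) (relabel \<psi>) (\<lambda>x. cls (\<phi> x) (\<psi> x) (Id C (u x)))"
proof -
  have Ob: "\<phi> x \<in> Ob" "\<psi> x \<in> Ob" and u: "u (\<phi> x) = u x" "u (\<psi> x) = u x" if "x \<in> Ob" for x
    using same[OF that that] by auto
  have HH: "H (\<phi> x) (\<phi> y) = H x y" "H (\<phi> x) (\<psi> y) = H x y" "H (\<psi> x) (\<phi> y) = H x y" "H (\<psi> x) (\<psi> y) = H x y"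
    and EE: "E (\<phi> x) (\<phi> y) = E x y" "E (\<phi> x) (\<psi> y) = E x y" "E (\<psi> x) (\<phi> y) = E x y" "E (\<psi> x) (\<psi> y) = E x y"
    if "x \<in> Ob" "y \<in> Ob" for x y using same[OF that] by auto
  have idid: "Id C (u x) \<cdot> Id C (u x) = Id C (u x)" if "x \<in> Ob" for x
    using that u_Obj Id_Hom Comp_Id_left by blast
  show ?thesis unfolding natural_iso_def
  proof (intro conjI ballI)
    fix x assume "x \<in> Obj Cls"
    then have x: "x \<in> Ob" by (simp add: class_cat_def)
    let ?\<eta> = "cls (\<phi> x) (\<psi> x) (Id C (u x))" and ?\<theta> = "cls (\<psi> x) (\<phi> x) (Id C (u x))"
    have \<eta>: "?\<eta> \<in> Hom Cls (\<phi> x) (\<psi> x)" and \<theta>: "?\<theta> \<in> Hom Cls (\<psi> x) (\<phi> x)"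
      using x Ob HH H_Id by (auto intro!: cls_Hom)
    then show "?\<eta> \<in> Hom Cls (on_obj (relabel \<phi>) x) (on_obj (relabel \<psi>) x)" by (simp add: relabel_def)
    have "?\<theta> \<cdot>\<^bsub>Cls\<^esub> ?\<eta> = Id Cls (\<phi> x)" "?\<eta> \<cdot>\<^bsub>Cls\<^esub> ?\<theta> = Id Cls (\<psi> x)"
      unfolding Cls_Id using x Ob HH u H_Id idid by (simp_all add: cls_Comp)
    then show "is_iso Cls ?\<eta>"
      using HomD[OF \<eta>] \<theta> unfolding is_iso_def by auto
  next
    fix f assume f: "f \<in> Arr Cls"
    obtain x y l where *: "x \<in> Ob" "y \<in> Ob" "l \<in> H x y" "f = cls x y l" using f by (rule Cls_ArrE)
    have "l \<in> Hom C (u x) (u y)" using * H_Hom by blast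
    then have "l \<cdot> Id C (u x) = l" "Id C (u y) \<cdot> l = l" by (rule Comp_Id_right Comp_Id_left)+
    moreover have "on_arr (relabel \<phi>) f = cls (\<phi> x) (\<phi> y) l" "on_arr (relabel \<psi>) f = cls (\<psi> x) (\<psi> y) l"
      using * EE by (simp_all add: relabel_def)
    moreover have "Dom Cls f = x" "Cod Cls f = y" using * HomD[OF cls_Hom[OF *(1-3)]] by simp_all
    ultimately show "cls (\<phi> (Cod Cls f)) (\<psi> (Cod Cls f)) (Id C (u (Cod Cls f))) \<cdot>\<^bsub>Cls\<^esub> on_arr (relabel \<phi>) f =
        on_arr (relabel \<psi>) f \<cdot>\<^bsub>Cls\<^esub> cls (\<phi> (Dom Cls f)) (\<psi> (Dom Cls f)) (Id C (u (Dom Cls f)))"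
      using * Ob HH H_Id by (simp add: cls_Comp)
  qed
qed

text \<open>
  Objects matched by \<open>k\<close> are indistinguishable by hom-sets and congruences, so any choice of a partner
  for every object, on either side, is an equivalence.  Using a relation rather than a function lets
  one object have many partners, as a morphism has many kernel pairs.  That the primed data
  form a category is a consequence: its hom-sets are those between chosen partners in \<open>Ob\<close>.
\<close>

lemma equivalent_categories_relabel:
  fixes Ob' :: "'y set" and k :: "'x \<Rightarrow> 'y \<Rightarrow> bool"
  assumes total: "\<And>x. x \<in> Ob \<Longrightarrow> \<exists>r\<in>Ob'. k x r" and onto: "\<And>r. r \<in> Ob' \<Longrightarrow> \<exists>x\<in>Ob. k x r"
    and same: "\<And>x y r s. x \<in> Ob \<Longrightarrow> y \<in> Ob \<Longrightarrow> r \<in> Ob' \<Longrightarrow> s \<in> Ob' \<Longrightarrow> k x r \<Longrightarrow> k y s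
        \<Longrightarrow> u' r = u x \<and> H' r s = H x y \<and> E' r s = E x y"
  shows "equivalent_categories Cls (class_cat C Ob' u' H' E')"
proof -
  obtain K where K: "\<And>x. x \<in> Ob \<Longrightarrow> K x \<in> Ob' \<and> k x (K x)" using total by metis
  obtain Q where Q: "\<And>r. r \<in> Ob' \<Longrightarrow> Q r \<in> Ob \<and> k (Q r) r" using onto by metis
  have Qs: "u' r = u (Q r)" "H' r s = H (Q r) (Q s)" "E' r s = E (Q r) (Q s)"
    if "r \<in> Ob'" "s \<in> Ob'" for r s
    using same[of "Q r" "Q s" r s] Q that by auto
  have T: "hom_congruence C Ob' u' H' E'"
  proof unfold_locales
    fix x assume "x \<in> Ob'"
    then show "u' x \<in> Obj C" "Id C (u' x) \<in> H' x x" using Qs Q u_Obj H_Id by auto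
  next
    fix x y assume "x \<in> Ob'" "y \<in> Ob'"
    then show "H' x y \<subseteq> Hom C (u' x) (u' y)" "equiv (H' x y) (E' x y)"
      using Qs Q H_Hom E_equiv by auto
  next
    fix x y z assume o: "x \<in> Ob'" "y \<in> Ob'" "z \<in> Ob'"
    show "m \<cdot> l \<in> H' x z" if "l \<in> H' x y" "m \<in> H' y z" for l m
      using that o Qs Q H_Comp[of "Q x" "Q y" "Q z"] by simp
    show "(m \<cdot> l, m' \<cdot> l') \<in> E' x z" if "(l, l') \<in> E' x y" "(m, m') \<in> E' y z" for l l' m m'
      using that o Qs Q E_Comp[of "Q x" "Q y" "Q z"] by simp
  qed
  then interpret T: hom_congruence C Ob' u' H' E' .
  have S: "hom_congruence C Ob u H E" ..
  have "is_functor Cls T.Cls (relabel K)"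
    by (rule is_functor_relabel[OF S T]) (use K same in blast)+
  moreover have "is_functor T.Cls Cls (relabel Q)"
    by (rule is_functor_relabel[OF T S]) (use Q Qs in auto)
  moreover have "natural_iso Cls Cls id_functor (comp_functor (relabel Q) (relabel K))
      (\<lambda>x. cls x (Q (K x)) (Id C (u x)))"
    unfolding comp_relabel id_relabel
  proof (rule natural_iso_relabel)
    fix x y a b assume o: "x \<in> Ob" "y \<in> Ob" and "a \<in> {x, Q (K x)}" "b \<in> {y, Q (K y)}"
    then have "a \<in> Ob" "b \<in> Ob" "k a (K x)" "k b (K y)" using K Q by auto
    then show "a \<in> Ob \<and> u a = u x \<and> H a b = H x y \<and> E a b = E x y"
      using same[of a b "K x" "K y"] same[of x y "K x" "K y"] K o by auto
  qed
  moreover have "natural_iso T.Cls T.Cls (comp_functor (relabel K) (relabel Q)) id_functor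
      (\<lambda>r. T.cls (K (Q r)) r (Id C (u' r)))"
    unfolding comp_relabel id_relabel
  proof (rule T.natural_iso_relabel)
    fix x y a b assume o: "x \<in> Ob'" "y \<in> Ob'" and "a \<in> {K (Q x), x}" "b \<in> {K (Q y), y}"
    then have "a \<in> Ob'" "b \<in> Ob'" "k (Q x) a" "k (Q y) b" using K Q by auto
    then show "a \<in> Ob' \<and> u' a = u' x \<and> H' a b = H' x y \<and> E' a b = E' x y"
      using same[of "Q x" "Q y" a b] same[of "Q x" "Q y" x y] Q o by auto
  qed
  ultimately show ?thesis
    unfolding equivalent_categories_def using category_Cls T.category_Cls by blast
qed

end


section \<open>Kernel pairs\<close>

context category begin

lemma pullbackE:
  assumes "is_pullback C f g p q" "f \<in> Hom C A B" "g \<in> Hom C D B"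
  obtains P where "p \<in> Hom C P A" "q \<in> Hom C P D"
    "\<And>T u v. u \<in> Hom C T A \<Longrightarrow> v \<in> Hom C T D \<Longrightarrow> f \<cdot> u = g \<cdot> v \<Longrightarrow>
         \<exists>k. k \<in> Hom C T P \<and> p \<cdot> k = u \<and> q \<cdot> k = v"
proof -
  have "Dom C f = A" "Dom C g = D" using assms HomD by metis+
  then show thesis using assms(1) that unfolding is_pullback_def by metis
qed

lemma kernel_pairE:
  assumes "is_kernel_pair C f r1 r2"
  obtains "f \<in> Arr C" "r1 \<in> Hom C (Dom C r1) (Dom C f)" "r2 \<in> Hom C (Dom C r1) (Dom C f)" "f \<cdot> r1 = f \<cdot> r2"
  using assms by (auto simp: is_kernel_pair_def is_pullback_def Hom_def)

lemma kernel_pair_lift: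
  assumes "is_kernel_pair C f r1 r2" "a \<in> Hom C T (Dom C f)" "b \<in> Hom C T (Dom C f)" "f \<cdot> a = f \<cdot> b"
  obtains j where "j \<in> Hom C T (Dom C r1)" "r1 \<cdot> j = a" "r2 \<cdot> j = b"
proof -
  obtain P where "r1 \<in> Hom C P (Dom C f)"
    "\<And>T u v. u \<in> Hom C T (Dom C f) \<Longrightarrow> v \<in> Hom C T (Dom C f) \<Longrightarrow> f \<cdot> u = f \<cdot> v \<Longrightarrow>
         \<exists>!k. k \<in> Hom C T P \<and> r1 \<cdot> k = u \<and> r2 \<cdot> k = v"
    using assms(1) unfolding is_kernel_pair_def is_pullback_def by blast
  then show ?thesis using that assms(2-4) by (metis HomD)
qed

text \<open>
  The two kernel pairs of \<open>f\<close> that occur here, the given one and the one witnessing \<open>reg_hom\<close>, factor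
  through each other; the rest is the universal property of the kernel pair of \<open>g\<close>.
\<close>

lemma reg_hom_eq_PER_hom:
  assumes f: "is_kernel_pair C f r1 r2" and g: "is_kernel_pair C g s1 s2"
  shows "reg_hom C f g = PER_hom C (r1, r2) (s1, s2)"
proof -
  from f have F: "f \<in> Arr C" "r1 \<in> Hom C (Dom C r1) (Dom C f)" "r2 \<in> Hom C (Dom C r1) (Dom C f)" "f \<cdot> r1 = f \<cdot> r2"
    by (rule kernel_pairE; blast)+
  from g have G: "g \<in> Arr C" "s1 \<in> Hom C (Dom C s1) (Dom C g)" "s2 \<in> Hom C (Dom C s1) (Dom C g)" "g \<cdot> s1 = g \<cdot> s2"
    by (rule kernel_pairE; blast)+
  have cod: "Cod C r1 = Dom C f" "Cod C s1 = Dom C g" using F G HomD by metis+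
  have gH: "g \<in> Hom C (Dom C g) (Cod C g)" by (rule HomI[OF G(1)])
  show ?thesis
  proof (intro set_eqI iffI)
    fix l assume "l \<in> reg_hom C f g"
    then obtain f0 f1 where l: "l \<in> Hom C (Dom C f) (Dom C g)"
      and k: "is_kernel_pair C f f0 f1" and eq: "g \<cdot> l \<cdot> f0 = g \<cdot> l \<cdot> f1"
      by (auto simp: reg_hom_def)
    have f01: "f0 \<in> Hom C (Dom C f0) (Dom C f)" "f1 \<in> Hom C (Dom C f0) (Dom C f)"
      using k by (rule kernel_pairE; blast)+
    obtain j where j: "j \<in> Hom C (Dom C r1) (Dom C f0)" "f0 \<cdot> j = r1" "f1 \<cdot> j = r2"
      using kernel_pair_lift[OF k F(2-4)] .
    have "g \<cdot> l \<cdot> r1 = (g \<cdot> l \<cdot> f0) \<cdot> j" "g \<cdot> l \<cdot> r2 = (g \<cdot> l \<cdot> f1) \<cdot> j"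
      using Comp_assoc_last[OF j(1) _ l gH] f01 j(2,3) by auto
    then have "g \<cdot> l \<cdot> r1 = g \<cdot> l \<cdot> r2" using eq by simp
    then obtain h where "h \<in> Hom C (Dom C r1) (Dom C s1)" "s1 \<cdot> h = l \<cdot> r1" "s2 \<cdot> h = l \<cdot> r2"
      using kernel_pair_lift[OF g Comp_Hom[OF F(2) l] Comp_Hom[OF F(3) l]] by metis
    then have "\<exists>h \<in> Hom C (Dom C r1) (Dom C s1). l \<cdot> r1 = s1 \<cdot> h \<and> l \<cdot> r2 = s2 \<cdot> h" by metis
    then show "l \<in> PER_hom C (r1, r2) (s1, s2)" using l cod by (simp add: PER_hom_def)
  next
    fix l assume "l \<in> PER_hom C (r1, r2) (s1, s2)"
    then obtain h where l: "l \<in> Hom C (Dom C f) (Dom C g)" and h: "h \<in> Hom C (Dom C r1) (Dom C s1)"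
      "l \<cdot> r1 = s1 \<cdot> h" "l \<cdot> r2 = s2 \<cdot> h" using cod by (auto simp: PER_hom_def)
    have "g \<cdot> s1 \<cdot> h = g \<cdot> s2 \<cdot> h"
      using Comp_assoc[OF h(1) G(2) gH] Comp_assoc[OF h(1) G(3) gH] G(4) by simp
    then have "g \<cdot> l \<cdot> r1 = g \<cdot> l \<cdot> r2" using h by simp
    then show "l \<in> reg_hom C f g" using l f unfolding reg_hom_def by blast
  qed
qed

lemma reg_rel_eq_PER_rel:
  assumes f: "is_kernel_pair C f r1 r2" and g: "is_kernel_pair C g s1 s2"
  shows "reg_rel C f g = PER_rel C (r1, r2) (s1, s2)"
proof -
  have r: "r1 \<in> Hom C (Dom C r1) (Dom C f)" using f by (rule kernel_pairE; blast)
  have G: "g \<in> Arr C" "s1 \<in> Hom C (Dom C s1) (Dom C g)" "s2 \<in> Hom C (Dom C s1) (Dom C g)" "g \<cdot> s1 = g \<cdot> s2"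
    using g by (rule kernel_pairE; blast)+
  have cod: "Cod C r1 = Dom C f" using r HomD by metis
  have gH: "g \<in> Hom C (Dom C g) (Cod C g)" by (rule HomI[OF G(1)])
  have "g \<cdot> l = g \<cdot> m \<longleftrightarrow> (\<exists>h\<in>Hom C (Dom C f) (Dom C s1). l = s1 \<cdot> h \<and> m = s2 \<cdot> h)"
    if "l \<in> Hom C (Dom C f) (Dom C g)" "m \<in> Hom C (Dom C f) (Dom C g)" for l m
  proof
    assume "g \<cdot> l = g \<cdot> m"
    then show "\<exists>h\<in>Hom C (Dom C f) (Dom C s1). l = s1 \<cdot> h \<and> m = s2 \<cdot> h"
      using kernel_pair_lift[OF g that] by metis
  next
    assume "\<exists>h\<in>Hom C (Dom C f) (Dom C s1). l = s1 \<cdot> h \<and> m = s2 \<cdot> h"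
    then obtain h where h: "h \<in> Hom C (Dom C f) (Dom C s1)" "l = s1 \<cdot> h" "m = s2 \<cdot> h" by blast
    then show "g \<cdot> l = g \<cdot> m"
      using Comp_assoc[OF h(1) G(2) gH] Comp_assoc[OF h(1) G(3) gH] G(4) by simp
  qed
  moreover have "l \<in> Hom C (Dom C f) (Dom C g)" if "l \<in> reg_hom C f g" for l
    using that by (simp add: reg_hom_def)
  ultimately have "(l, m) \<in> reg_rel C f g \<longleftrightarrow> (l, m) \<in> PER_rel C (r1, r2) (s1, s2)" for l m
    unfolding reg_rel_def PER_rel_def by (auto simp: cod reg_hom_eq_PER_hom[OF f g, symmetric])
  then show ?thesis by auto
qed

text \<open>
  A representative \<open>l\<close> from \<open>f\<close> to \<open>g\<close> turns every pair identified by \<open>f\<close> into a pair identified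
  by \<open>g\<close>, because such a pair factors through the kernel pair; this gives closure under composition
  and compatibility with the congruence.
\<close>

lemma reg_hom_congruence:
  assumes ker: "\<And>f. f \<in> Arr C \<Longrightarrow> \<exists>f0 f1. is_kernel_pair C f f0 f1"
  shows "hom_congruence C (Arr C) (Dom C) (reg_hom C) (reg_rel C)"
proof -
  have collapse: "g \<cdot> l \<cdot> a = g \<cdot> l \<cdot> b"
    if l: "l \<in> reg_hom C f g" and f: "f \<in> Arr C" and g: "g \<in> Arr C"
      and ab: "a \<in> Hom C T (Dom C f)" "b \<in> Hom C T (Dom C f)" "f \<cdot> a = f \<cdot> b" for f g l a b T
  proof -
    obtain f0 f1 where l: "l \<in> Hom C (Dom C f) (Dom C g)"
      and k: "is_kernel_pair C f f0 f1" and eq: "g \<cdot> l \<cdot> f0 = g \<cdot> l \<cdot> f1"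
      using l by (auto simp: reg_hom_def)
    have f01: "f0 \<in> Hom C (Dom C f0) (Dom C f)" "f1 \<in> Hom C (Dom C f0) (Dom C f)"
      using k by (rule kernel_pairE; blast)+
    obtain j where j: "j \<in> Hom C T (Dom C f0)" "f0 \<cdot> j = a" "f1 \<cdot> j = b"
      using kernel_pair_lift[OF k ab] .
    have "g \<cdot> l \<cdot> a = (g \<cdot> l \<cdot> f0) \<cdot> j" "g \<cdot> l \<cdot> b = (g \<cdot> l \<cdot> f1) \<cdot> j"
      using Comp_assoc_last[OF j(1) _ l HomI[OF g]] f01 j(2,3) by auto
    then show ?thesis using eq by simp
  qed
  have in_Hom: "l \<in> Hom C (Dom C f) (Dom C g)" if "l \<in> reg_hom C f g" for l f g
    using that by (simp add: reg_hom_def)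
  have closed: "m \<cdot> l \<in> reg_hom C f h"
    if o: "f \<in> Arr C" "g \<in> Arr C" "h \<in> Arr C" and l: "l \<in> reg_hom C f g" and m: "m \<in> reg_hom C g h"
    for f g h l m
  proof -
    obtain f0 f1 where k: "is_kernel_pair C f f0 f1" using ker o by blast
    have F: "f0 \<in> Hom C (Dom C f0) (Dom C f)" "f1 \<in> Hom C (Dom C f0) (Dom C f)" "f \<cdot> f0 = f \<cdot> f1"
      using k by (rule kernel_pairE; blast)+
    have "h \<cdot> m \<cdot> l \<cdot> f0 = h \<cdot> m \<cdot> l \<cdot> f1"
      using collapse[OF m o(2,3) Comp_Hom[OF F(1) in_Hom[OF l]] Comp_Hom[OF F(2) in_Hom[OF l]]]
        collapse[OF l o(1,2) F] by blast
    then have "h \<cdot> (m \<cdot> l) \<cdot> f0 = h \<cdot> (m \<cdot> l) \<cdot> f1"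
      using F in_Hom[OF l] in_Hom[OF m] by (simp add: Comp_assoc)
    then show ?thesis
      using k Comp_Hom[OF in_Hom[OF l] in_Hom[OF m]] by (auto simp: reg_hom_def)
  qed
  show ?thesis
  proof unfold_locales
    fix f assume f: "f \<in> Arr C"
    then show "Dom C f \<in> Obj C" by (rule Dom_Obj)
    obtain f0 f1 where k: "is_kernel_pair C f f0 f1" using ker f by blast
    have F: "f0 \<in> Hom C (Dom C f0) (Dom C f)" "f1 \<in> Hom C (Dom C f0) (Dom C f)" "f \<cdot> f0 = f \<cdot> f1"
      using k by (rule kernel_pairE; blast)+
    have "f \<cdot> Id C (Dom C f) \<cdot> f0 = f \<cdot> Id C (Dom C f) \<cdot> f1"
      using F by (simp add: Comp_Id_left[OF F(1)] Comp_Id_left[OF F(2)])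
    then show "Id C (Dom C f) \<in> reg_hom C f f"
      using k Id_Hom[OF Dom_Obj[OF f]] unfolding reg_hom_def by blast
  next
    fix f g
    show "reg_hom C f g \<subseteq> Hom C (Dom C f) (Dom C g)" by (auto simp: reg_hom_def)
    show "equiv (reg_hom C f g) (reg_rel C f g)"
      by (rule equivI) (auto simp: reg_rel_def refl_on_def sym_def trans_def)
  next
    fix f g h l m
    assume "f \<in> Arr C" "g \<in> Arr C" "h \<in> Arr C" "l \<in> reg_hom C f g" "m \<in> reg_hom C g h"
    then show "m \<cdot> l \<in> reg_hom C f h" by (rule closed)
  next
    fix f g h l l' m m'
    assume o: "f \<in> Arr C" "g \<in> Arr C" "h \<in> Arr C"
      and ll: "(l, l') \<in> reg_rel C f g" and mm: "(m, m') \<in> reg_rel C g h"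
    have R: "l \<in> reg_hom C f g" "l' \<in> reg_hom C f g" "m \<in> reg_hom C g h" "m' \<in> reg_hom C g h"
      "g \<cdot> l = g \<cdot> l'" "h \<cdot> m = h \<cdot> m'" using ll mm by (auto simp: reg_rel_def)
    have Homs: "l \<in> Hom C (Dom C f) (Dom C g)" "l' \<in> Hom C (Dom C f) (Dom C g)"
      "m \<in> Hom C (Dom C g) (Dom C h)" "m' \<in> Hom C (Dom C g) (Dom C h)" using R in_Hom by blast+
    have "h \<cdot> m \<cdot> l = h \<cdot> m' \<cdot> l"
      using Comp_assoc[OF Homs(1,3) HomI[OF o(3)]] Comp_assoc[OF Homs(1,4) HomI[OF o(3)]] R(6) by simp
    also have "\<dots> = h \<cdot> m' \<cdot> l'" using collapse[OF R(4) o(2,3) Homs(1,2) R(5)] .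
    finally have eq: "h \<cdot> m \<cdot> l = h \<cdot> m' \<cdot> l'" .
    then show "(m \<cdot> l, m' \<cdot> l') \<in> reg_rel C f h"
      using closed[OF o R(1,3)] closed[OF o R(2,4)] by (simp add: reg_rel_def)
  qed
qed

lemma kernel_pair_pseudo_equiv_rel:
  assumes k: "is_kernel_pair C f r1 r2"
  shows "pseudo_equiv_rel C (r1, r2)"
proof -
  let ?A = "Dom C f" and ?R = "Dom C r1"
  have F: "f \<in> Arr C" "r1 \<in> Hom C ?R ?A" "r2 \<in> Hom C ?R ?A" "f \<cdot> r1 = f \<cdot> r2"
    using k by (rule kernel_pairE; blast)+
  have fH: "f \<in> Hom C ?A (Cod C f)" by (rule HomI[OF F(1)])
  have A: "Id C ?A \<in> Hom C ?A ?A" using F Dom_Obj Id_Hom by blast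
  have "\<exists>r \<in> Hom C ?A ?R. r1 \<cdot> r = Id C ?A \<and> r2 \<cdot> r = Id C ?A"
    using kernel_pair_lift[OF k A A] by blast
  moreover have "\<exists>s \<in> Hom C ?R ?R. r1 \<cdot> s = r2 \<and> r2 \<cdot> s = r1"
    using kernel_pair_lift[OF k F(3) F(2)] F(4) by metis
  moreover have "\<exists>t \<in> Hom C (Dom C r3) ?R. r1 \<cdot> t = r1 \<cdot> r3 \<and> r2 \<cdot> t = r2 \<cdot> r4"
    if pb: "is_pullback C r2 r1 r3 r4" for r3 r4
  proof -
    have P: "r3 \<in> Hom C (Dom C r3) ?R" "r4 \<in> Hom C (Dom C r3) ?R" "r2 \<cdot> r3 = r1 \<cdot> r4"
      using pb F(3) unfolding is_pullback_def by (auto simp: Hom_def)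
    have "f \<cdot> r1 \<cdot> r3 = f \<cdot> r2 \<cdot> r3" "f \<cdot> r1 \<cdot> r4 = f \<cdot> r2 \<cdot> r4"
      using Comp_assoc[OF P(1) F(2) fH] Comp_assoc[OF P(1) F(3) fH]
        Comp_assoc[OF P(2) F(2) fH] Comp_assoc[OF P(2) F(3) fH] F(4) by simp_all
    then have "f \<cdot> r1 \<cdot> r3 = f \<cdot> r2 \<cdot> r4" using P(3) by simp
    then show ?thesis
      using kernel_pair_lift[OF k Comp_Hom[OF P(1) F(2)] Comp_Hom[OF P(2) F(3)]] by metis
  qed
  ultimately show ?thesis using F unfolding pseudo_equiv_rel_def by blast
qed

lemma pullback_from_equalizer:
  assumes f: "f \<in> Hom C A B" and g: "g \<in> Hom C A B"
    and prod: "is_product C A A p q" and eq: "is_equalizer C (f \<cdot> p) (g \<cdot> q) m"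
  shows "is_pullback C f g (p \<cdot> m) (q \<cdot> m)"
proof -
  obtain P where p: "p \<in> Hom C P A" and q: "q \<in> Hom C P A"
    and univ: "\<And>T u v. u \<in> Hom C T A \<Longrightarrow> v \<in> Hom C T A \<Longrightarrow> \<exists>!k. k \<in> Hom C T P \<and> p \<cdot> k = u \<and> q \<cdot> k = v"
    using prod unfolding is_product_def by blast
  have fp: "Dom C (f \<cdot> p) = P" using Comp_Hom[OF p f] HomD by metis
  obtain R where m: "m \<in> Hom C R P" and meq: "(f \<cdot> p) \<cdot> m = (g \<cdot> q) \<cdot> m"
    and euniv: "\<And>T u. u \<in> Hom C T P \<Longrightarrow> (f \<cdot> p) \<cdot> u = (g \<cdot> q) \<cdot> u \<Longrightarrow> \<exists>!k. k \<in> Hom C T R \<and> m \<cdot> k = u"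
    using eq unfolding is_equalizer_def fp by blast
  have "\<exists>!k. k \<in> Hom C T R \<and> (p \<cdot> m) \<cdot> k = u \<and> (q \<cdot> m) \<cdot> k = v"
    if uv: "u \<in> Hom C T A" "v \<in> Hom C T A" "f \<cdot> u = g \<cdot> v" for T u v
  proof -
    obtain d where d: "d \<in> Hom C T P" "p \<cdot> d = u" "q \<cdot> d = v" using univ[OF uv(1,2)] by blast
    have "(f \<cdot> p) \<cdot> d = (g \<cdot> q) \<cdot> d" using d uv(3) p q f g by (simp add: Comp_assoc)
    then obtain k where k: "k \<in> Hom C T R" "m \<cdot> k = d" and ku: "\<And>k'. k' \<in> Hom C T R \<Longrightarrow> m \<cdot> k' = d \<Longrightarrow> k' = k"
      using euniv[OF d(1)] by blast
    show ?thesis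
    proof (rule ex1I[of _ k])
      show "k \<in> Hom C T R \<and> (p \<cdot> m) \<cdot> k = u \<and> (q \<cdot> m) \<cdot> k = v"
        using k d Comp_assoc[OF k(1) m p] Comp_assoc[OF k(1) m q] by simp
    next
      fix k' assume k': "k' \<in> Hom C T R \<and> (p \<cdot> m) \<cdot> k' = u \<and> (q \<cdot> m) \<cdot> k' = v"
      then have "p \<cdot> m \<cdot> k' = u" "q \<cdot> m \<cdot> k' = v" "m \<cdot> k' \<in> Hom C T P"
        using Comp_assoc[OF _ m p, of k' T] Comp_assoc[OF _ m q, of k' T] Comp_Hom[OF _ m, of k' T] by auto
      then have "m \<cdot> k' = d" using univ[OF uv(1,2)] d by blast
      then show "k' = k" using ku k' by blast
    qed
  qed
  moreover have "f \<cdot> p \<cdot> m = g \<cdot> q \<cdot> m" using meq m p q f g by (simp add: Comp_assoc)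
  moreover have "f \<in> Arr C" "g \<in> Arr C" "Dom C f = A" "Dom C g = A" "Cod C f = B" "Cod C g = B"
    using f g HomD by metis+
  ultimately show ?thesis
    using Comp_Hom[OF m p] Comp_Hom[OF m q] unfolding is_pullback_def by (intro conjI exI[of _ R]) auto
qed

end


section \<open>Small sets\<close>

lemma universe_subset: "set_universe U \<Longrightarrow> A \<in> U \<Longrightarrow> B \<subseteq> A \<Longrightarrow> B \<in> U"
  unfolding set_universe_def by blast

lemma universe_image:
  fixes U :: "'u set set" and f :: "'u \<Rightarrow> 'u"
  assumes "set_universe U" "A \<in> U"
  shows "f ` A \<in> U"
  using assms(1)[unfolded set_universe_def, THEN conjunct2, THEN conjunct2, THEN conjunct1] assms(2)
  by blast

lemma universe_Pow:
  fixes U :: "'u set set"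
  assumes "set_universe U" "A \<in> U"
  obtains p :: "'u set \<Rightarrow> 'u" where "inj_on p (Pow A)" "p ` Pow A \<in> U"
  using assms(1)[unfolded set_universe_def, THEN conjunct2, THEN conjunct2, THEN conjunct2, THEN conjunct2]
    assms(2) by blast

lemma universe_singleton:
  fixes U :: "'u set set"
  assumes U: "set_universe U"
  shows "{x} \<in> U"
proof -
  have "{} \<in> U" using U by (simp add: set_universe_def)
  then obtain p :: "'u set \<Rightarrow> 'u" where p: "p ` Pow {} \<in> U" using universe_Pow[OF U] by metis
  have "(\<lambda>_. x) ` p ` Pow {} \<in> U" by (rule universe_image[OF U p])
  moreover have "(\<lambda>_. x) ` p ` Pow {} = {x}" by auto
  ultimately show ?thesis by simp
qed

text \<open>
  Kuratowski pairs: two applications of the power set contain a copy of the product.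
\<close>

lemma universe_square:
  fixes U :: "'u set set"
  assumes U: "set_universe U" and A: "A \<in> U"
  obtains pr where "inj_on pr (A \<times> A)" "pr ` (A \<times> A) \<in> U"
proof -
  obtain p where p: "inj_on p (Pow A)" "p ` Pow A \<in> U" using universe_Pow[OF U A] .
  obtain p' where p': "inj_on p' (Pow (p ` Pow A))" "p' ` Pow (p ` Pow A) \<in> U"
    using universe_Pow[OF U p(2)] .
  define pr where "pr = (\<lambda>(a, b). p' {p {a}, p {a, b}})"
  have "inj_on pr (A \<times> A)"
  proof (rule inj_onI, clarify)
    fix a b c d assume o: "a \<in> A" "b \<in> A" "c \<in> A" "d \<in> A" and "pr (a, b) = pr (c, d)"
    then have "{p {a}, p {a, b}} = {p {c}, p {c, d}}"
      using inj_onD[OF p'(1), of "{p {a}, p {a, b}}" "{p {c}, p {c, d}}"] by (auto simp: pr_def)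
    moreover have "p S = p T \<longleftrightarrow> S = T" if "S \<subseteq> A" "T \<subseteq> A" for S T
      using inj_on_eq_iff[OF p(1)] that by auto
    ultimately have "{{a}, {a, b}} = {{c}, {c, d}}" using o by (simp add: doubleton_eq_iff)
    then show "a = c \<and> b = d" by (auto simp: doubleton_eq_iff)
  qed
  moreover have "pr ` (A \<times> A) \<subseteq> p' ` Pow (p ` Pow A)" by (auto simp: pr_def)
  then have "pr ` (A \<times> A) \<in> U" by (rule universe_subset[OF U p'(2)])
  ultimately show ?thesis by (rule that)
qed


section \<open>Topological categories over sets\<close>

locale topological_over_sets = category X for X :: "('o, 'a) cat" (structure) +
  fixes U :: "'u set set" and F :: "('o, 'a, 'u set, 'u set \<times> ('u \<Rightarrow> 'u) \<times> 'u set) cat_functor"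
  assumes universe: "set_universe U" and topological: "topological X (Set_cat U) F"
begin

abbreviation pts :: "'o \<Rightarrow> 'u set" ("\<langle>_\<rangle>") where "\<langle>A\<rangle> \<equiv> on_obj F A"

definition fn :: "'a \<Rightarrow> 'u \<Rightarrow> 'u" where "fn f = fst (snd (on_arr F f))"

lemma functor_F: "is_functor X (Set_cat U) F"
  using topological by (simp add: topological_def)

lemma pts_U: "A \<in> Obj X \<Longrightarrow> \<langle>A\<rangle> \<in> U"
  using functor_F by (simp add: is_functor_def Set_cat_def)

lemma on_arr_F:
  assumes "f \<in> Hom X A B"
  shows "on_arr F f = (\<langle>A\<rangle>, fn f, \<langle>B\<rangle>)" and "fn f \<in> \<langle>A\<rangle> \<rightarrow>\<^sub>E \<langle>B\<rangle>"
proof -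
  have "on_arr F f \<in> Hom (Set_cat U) \<langle>A\<rangle> \<langle>B\<rangle>"
    using functor_F assms unfolding is_functor_def by (auto simp: Hom_def)
  then show "on_arr F f = (\<langle>A\<rangle>, fn f, \<langle>B\<rangle>)" "fn f \<in> \<langle>A\<rangle> \<rightarrow>\<^sub>E \<langle>B\<rangle>"
    by (auto simp: Hom_def Set_cat_def fn_def)
qed

lemma fn_in: "f \<in> Hom X A B \<Longrightarrow> a \<in> \<langle>A\<rangle> \<Longrightarrow> fn f a \<in> \<langle>B\<rangle>"
  using on_arr_F(2) by blast

lemma fn_comp:
  assumes "f \<in> Hom X A B" "g \<in> Hom X B D" "a \<in> \<langle>A\<rangle>"
  shows "fn (g \<cdot> f) a = fn g (fn f a)"
proof -
  have "on_arr F (g \<cdot> f) = on_arr F g \<cdot>\<^bsub>Set_cat U\<^esub> on_arr F f"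
    using functor_F assms unfolding is_functor_def by (auto simp: Hom_def)
  also have "\<dots> = (\<langle>A\<rangle>, compose \<langle>A\<rangle> (fn g) (fn f), \<langle>D\<rangle>)"
    using on_arr_F(1)[OF assms(1)] on_arr_F(1)[OF assms(2)] by (simp add: Set_cat_def)
  finally show ?thesis using assms(3) by (simp add: fn_def compose_def)
qed

lemma lifting_exists:
  fixes I :: "('o \<times> 'a \<times> ('u set \<times> ('u \<Rightarrow> 'u) \<times> 'u set)) set"
  assumes "is_structured_source X (Set_cat U) F S I Y f"
  obtains A' f' where "is_lifting X F S I Y f A' f'" "is_initial_source X (Set_cat U) F A' I Y f'"
proof -
  have "\<exists>!(A', f'). f' \<in> extensional I \<and> is_lifting X F S I Y f A' f'
      \<and> is_initial_source X (Set_cat U) F A' I Y f'"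
    by (rule topological[unfolded topological_def, THEN conjunct2, rule_format, OF assms])
  from ex1_implies_ex[OF this] show thesis using that by auto
qed

lemma initial_sourceD:
  assumes "is_initial_source X (Set_cat U) F A I Y l" "T \<in> Obj X"
    and "\<And>i. i \<in> I \<Longrightarrow> G i \<in> Hom X T (Y i)" "h \<in> Hom (Set_cat U) \<langle>T\<rangle> \<langle>A\<rangle>"
    and "\<And>i. i \<in> I \<Longrightarrow> on_arr F (G i) = on_arr F (l i) \<cdot>\<^bsub>Set_cat U\<^esub> h"
  shows "\<exists>k. k \<in> Hom X T A \<and> on_arr F k = h \<and> (\<forall>i\<in>I. G i = l i \<cdot> k)"
  using assms(1)[unfolded is_initial_source_def, rule_format, OF assms(2), of G h] assms(3-5) by blast

text \<open>
  Suppose \<open>f \<noteq> g\<close> have the same image under \<open>F\<close>, and lift the source consisting of one copy of this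
  image for every element \<open>k\<close> of the type of arrows.  Initiality realizes every family with values
  \<open>f\<close> and \<open>g\<close> as composites \<open>l k \<cdot> c\<close> with a single arrow \<open>c\<close>.  Cantor's diagonal family takes at \<open>k\<close> a value different from
  \<open>l k \<cdot> k\<close>, which is contradictory at \<open>k = c\<close>.
\<close>

lemma faithful:
  assumes f: "f \<in> Hom X A B" and g: "g \<in> Hom X A B" and fg: "\<And>a. a \<in> \<langle>A\<rangle> \<Longrightarrow> fn f a = fn g a"
  shows "f = g"
proof (rule ccontr)
  assume neq: "f \<noteq> g"
  have Ff: "on_arr F f = on_arr F g"
    using on_arr_F[OF f] on_arr_F[OF g] fg by (auto simp: PiE_ext)
  have AB: "A \<in> Obj X" "B \<in> Obj X" using Hom_Obj[OF f] by auto
  define ix :: "'a \<Rightarrow> 'o \<times> 'a \<times> ('u set \<times> ('u \<Rightarrow> 'u) \<times> 'u set)"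
    where "ix k = (undefined, k, undefined)" for k
  have ix: "the_inv ix (ix k) = k" for k by (rule the_inv_f_f) (auto simp: ix_def inj_def)
  have "on_arr F f \<in> Hom (Set_cat U) \<langle>A\<rangle> \<langle>B\<rangle>"
    using functor_F f unfolding is_functor_def by (auto simp: Hom_def)
  then have "is_structured_source X (Set_cat U) F \<langle>A\<rangle> (range ix) (\<lambda>_. B) (\<lambda>_. on_arr F f)"
    using AB pts_U by (simp add: is_structured_source_def Set_cat_def)
  then obtain L l where lift: "is_lifting X F \<langle>A\<rangle> (range ix) (\<lambda>_. B) (\<lambda>_. on_arr F f) L l"
    and init: "is_initial_source X (Set_cat U) F L (range ix) (\<lambda>_. B) l" by (rule lifting_exists)
  define h where "h i = (if l i \<cdot> the_inv ix i = f then g else f)" for i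
  have id: "(\<langle>A\<rangle>, restrict (\<lambda>x. x) \<langle>A\<rangle>, \<langle>A\<rangle>) \<in> Hom (Set_cat U) \<langle>A\<rangle> \<langle>L\<rangle>"
    using lift AB pts_U by (auto simp: is_lifting_def Hom_def Set_cat_def)
  have Fh: "on_arr F (h i) = on_arr F (l i) \<cdot>\<^bsub>Set_cat U\<^esub> (\<langle>A\<rangle>, restrict (\<lambda>x. x) \<langle>A\<rangle>, \<langle>A\<rangle>)" if "i \<in> range ix" for i
  proof -
    have "on_arr F (l i) = on_arr F f" using lift that unfolding is_lifting_def by blast
    moreover have "on_arr F (h i) = on_arr F f" using Ff by (simp add: h_def)
    moreover have "compose \<langle>A\<rangle> (fn f) (restrict (\<lambda>x. x) \<langle>A\<rangle>) = fn f"
      using on_arr_F(2)[OF f] by (auto simp: compose_def fun_eq_iff PiE_def extensional_def)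
    ultimately show ?thesis using on_arr_F(1)[OF f] by (simp add: Set_cat_def)
  qed
  have hH: "h i \<in> Hom X A B" for i using f g by (simp add: h_def)
  obtain k where k: "\<forall>i\<in>range ix. h i = l i \<cdot> k"
    using initial_sourceD[OF init AB(1), of h, OF hH id Fh] by auto
  have "h (ix k) = l (ix k) \<cdot> k" using k by blast
  then show False using neq by (auto simp: h_def ix split: if_splits)
qed

text \<open>
  A source without repetitions is its own index set, which leaves a set of pairs of an object and a
  function into its underlying set.  By faithfulness it is enough to describe arrows by their
  underlying functions.
\<close>

lemma initial_lift:
  assumes S: "S \<in> U" and src: "\<And>B \<phi>. (B, \<phi>) \<in> \<S> \<Longrightarrow> B \<in> Obj X \<and> \<phi> \<in> S \<rightarrow> \<langle>B\<rangle>"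
  obtains A where "A \<in> Obj X" "\<langle>A\<rangle> = S"
    "\<And>B \<phi>. (B, \<phi>) \<in> \<S> \<Longrightarrow> \<exists>f \<in> Hom X A B. \<forall>x\<in>S. fn f x = \<phi> x"
    "\<And>T h. T \<in> Obj X \<Longrightarrow> h \<in> \<langle>T\<rangle> \<rightarrow> S
      \<Longrightarrow> (\<And>B \<phi>. (B, \<phi>) \<in> \<S> \<Longrightarrow> \<exists>g \<in> Hom X T B. \<forall>t\<in>\<langle>T\<rangle>. fn g t = \<phi> (h t))
      \<Longrightarrow> \<exists>k \<in> Hom X T A. \<forall>t\<in>\<langle>T\<rangle>. fn k t = h t"
proof -
  define arr :: "'o \<times> ('u \<Rightarrow> 'u) \<Rightarrow> 'u set \<times> ('u \<Rightarrow> 'u) \<times> 'u set"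
    where "arr = (\<lambda>(B, \<phi>). (S, restrict \<phi> S, \<langle>B\<rangle>))"
  define ix :: "'o \<times> ('u \<Rightarrow> 'u) \<Rightarrow> 'o \<times> 'a \<times> ('u set \<times> ('u \<Rightarrow> 'u) \<times> 'u set)"
    where "ix b = (fst b, undefined, arr b)" for b
  define Y \<psi> where "Y i = fst i" and "\<psi> i = snd (snd i)"
    for i :: "'o \<times> 'a \<times> ('u set \<times> ('u \<Rightarrow> 'u) \<times> 'u set)"
  have Y: "Y (ix b) = fst b" and \<psi>: "\<psi> (ix b) = arr b" for b by (simp_all add: Y_def \<psi>_def ix_def)
  have "is_structured_source X (Set_cat U) F S (ix ` \<S>) Y \<psi>"
    unfolding is_structured_source_def
  proof (intro conjI ballI)
    show "S \<in> Obj (Set_cat U)" using S by (simp add: Set_cat_def)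
    fix i assume "i \<in> ix ` \<S>"
    then obtain B \<phi> where b: "(B, \<phi>) \<in> \<S>" "i = ix (B, \<phi>)" by auto
    then show "Y i \<in> Obj X" using src by (simp add: Y)
    show "\<psi> i \<in> Hom (Set_cat U) S \<langle>Y i\<rangle>"
      using b src[OF b(1)] S pts_U by (auto simp: Y \<psi> arr_def Set_cat_def Hom_def)
  qed
  then obtain A l where lift: "is_lifting X F S (ix ` \<S>) Y \<psi> A l"
    and init: "is_initial_source X (Set_cat U) F A (ix ` \<S>) Y l" by (rule lifting_exists)
  have A: "A \<in> Obj X" "\<langle>A\<rangle> = S" using lift by (auto simp: is_lifting_def)
  have l: "l (ix (B, \<phi>)) \<in> Hom X A B" "on_arr F (l (ix (B, \<phi>))) = (S, restrict \<phi> S, \<langle>B\<rangle>)"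
    if "(B, \<phi>) \<in> \<S>" for B \<phi>
    using lift that Y[of "(B, \<phi>)"] \<psi>[of "(B, \<phi>)"] by (auto simp: is_lifting_def arr_def)
  show thesis
  proof (rule that[OF A])
    fix B \<phi> assume "(B, \<phi>) \<in> \<S>"
    from l[OF this] show "\<exists>f \<in> Hom X A B. \<forall>x\<in>S. fn f x = \<phi> x"
      by (intro bexI[of _ "l (ix (B, \<phi>))"]) (simp_all add: fn_def)
  next
    fix T h
    assume T: "T \<in> Obj X" and h: "h \<in> \<langle>T\<rangle> \<rightarrow> S"
      and ex: "\<And>B \<phi>. (B, \<phi>) \<in> \<S> \<Longrightarrow> \<exists>g \<in> Hom X T B. \<forall>t\<in>\<langle>T\<rangle>. fn g t = \<phi> (h t)"
    let ?h = "(\<langle>T\<rangle>, restrict h \<langle>T\<rangle>, S)"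
    have "\<exists>g. g \<in> Hom X T (Y i) \<and> on_arr F g = on_arr F (l i) \<cdot>\<^bsub>Set_cat U\<^esub> ?h" if i: "i \<in> ix ` \<S>" for i
    proof -
      obtain B \<phi> where b: "(B, \<phi>) \<in> \<S>" "i = ix (B, \<phi>)" using i by auto
      obtain g where g: "g \<in> Hom X T B" "\<forall>t\<in>\<langle>T\<rangle>. fn g t = \<phi> (h t)" using ex[OF b(1)] by blast
      have "fn g = compose \<langle>T\<rangle> (restrict \<phi> S) (restrict h \<langle>T\<rangle>)"
        using on_arr_F(2)[OF g(1)] g(2) h
        by (auto simp: compose_def fun_eq_iff PiE_def extensional_def Pi_def)
      then show ?thesis
        using g(1) on_arr_F(1)[OF g(1)] l(2)[OF b(1)] b(2) Y[of "(B, \<phi>)"] by (auto simp: Set_cat_def)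
    qed
    then obtain G where G: "\<And>i. i \<in> ix ` \<S> \<Longrightarrow> G i \<in> Hom X T (Y i)"
      "\<And>i. i \<in> ix ` \<S> \<Longrightarrow> on_arr F (G i) = on_arr F (l i) \<cdot>\<^bsub>Set_cat U\<^esub> ?h" by metis
    have hS: "?h \<in> Hom (Set_cat U) \<langle>T\<rangle> \<langle>A\<rangle>"
      using h S A T pts_U by (auto simp: Hom_def Set_cat_def)
    obtain k where "k \<in> Hom X T A" "on_arr F k = ?h"
      using initial_sourceD[OF init T, of G, OF G(1) hS G(2)] by auto
    then show "\<exists>k \<in> Hom X T A. \<forall>t\<in>\<langle>T\<rangle>. fn k t = h t"
      by (intro bexI[of _ k]) (simp_all add: fn_def)
  qed
qed

text \<open>
  The initial lifting of all constant functions from a one-point set is a discrete point: each of its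
  functions into an object is a morphism.  Arrows out of it therefore represent points, which is how
  universal properties in \<open>X\<close> are turned into statements about points.
\<close>

lemma discrete_point:
  obtains D a where "D \<in> Obj X" "\<langle>D\<rangle> = {a}"
    "\<And>B x. B \<in> Obj X \<Longrightarrow> x \<in> \<langle>B\<rangle> \<Longrightarrow> \<exists>d \<in> Hom X D B. fn d a = x"
proof -
  let ?S = "{undefined :: 'u}" and ?src = "{(B, \<phi>). B \<in> Obj X \<and> (\<exists>x\<in>\<langle>B\<rangle>. \<phi> = (\<lambda>_. x))}"
  obtain D where D: "D \<in> Obj X" "\<langle>D\<rangle> = ?S"
    "\<And>B \<phi>. (B, \<phi>) \<in> ?src \<Longrightarrow> \<exists>f \<in> Hom X D B. \<forall>x\<in>?S. fn f x = \<phi> x"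
    by (rule initial_lift[OF universe_singleton[OF universe, of undefined], of ?src]) auto
  have "\<exists>d \<in> Hom X D B. fn d undefined = x" if "B \<in> Obj X" "x \<in> \<langle>B\<rangle>" for B x
    using D(3)[of B "\<lambda>_. x"] that by auto
  then show thesis by (rule that[OF D(1,2)])
qed

text \<open>
  The product is the initial lifting of the two projections from a small copy of the set
  \<open>\<langle>A\<rangle> \<times> \<langle>A\<rangle>\<close>.
\<close>

lemma self_product:
  assumes A: "A \<in> Obj X"
  obtains p q where "is_product X A A p q"
proof -
  obtain pr where pr: "inj_on pr (\<langle>A\<rangle> \<times> \<langle>A\<rangle>)" "pr ` (\<langle>A\<rangle> \<times> \<langle>A\<rangle>) \<in> U"
    using universe_square[OF universe pts_U[OF A]] .
  define S where "S = pr ` (\<langle>A\<rangle> \<times> \<langle>A\<rangle>)"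
  define \<pi> where "\<pi> = the_inv_into (\<langle>A\<rangle> \<times> \<langle>A\<rangle>) pr"
  have \<pi>: "\<pi> (pr (a, b)) = (a, b)" if "a \<in> \<langle>A\<rangle>" "b \<in> \<langle>A\<rangle>" for a b
    using that the_inv_into_f_f[OF pr(1), of "(a, b)"] by (simp add: \<pi>_def)
  let ?src = "{(A, \<lambda>z. fst (\<pi> z)), (A, \<lambda>z. snd (\<pi> z))}"
  obtain P where P: "P \<in> Obj X" "\<langle>P\<rangle> = S"
    and proj: "\<And>B \<phi>. (B, \<phi>) \<in> ?src \<Longrightarrow> \<exists>f \<in> Hom X P B. \<forall>x\<in>S. fn f x = \<phi> x"
    and univ: "\<And>T h. T \<in> Obj X \<Longrightarrow> h \<in> \<langle>T\<rangle> \<rightarrow> S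
      \<Longrightarrow> (\<And>B \<phi>. (B, \<phi>) \<in> ?src \<Longrightarrow> \<exists>g \<in> Hom X T B. \<forall>t\<in>\<langle>T\<rangle>. fn g t = \<phi> (h t))
      \<Longrightarrow> \<exists>k \<in> Hom X T P. \<forall>t\<in>\<langle>T\<rangle>. fn k t = h t"
    by (rule initial_lift[of S ?src]) (use pr(2) A in \<open>auto simp: S_def \<pi>\<close>)
  obtain p where p: "p \<in> Hom X P A" "\<And>z. z \<in> S \<Longrightarrow> fn p z = fst (\<pi> z)"
    using proj[of A "\<lambda>z. fst (\<pi> z)"] by auto
  obtain q where q: "q \<in> Hom X P A" "\<And>z. z \<in> S \<Longrightarrow> fn q z = snd (\<pi> z)"
    using proj[of A "\<lambda>z. snd (\<pi> z)"] by auto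
  have "\<exists>!k. k \<in> Hom X T P \<and> p \<cdot> k = u \<and> q \<cdot> k = v"
    if u: "u \<in> Hom X T A" and v: "v \<in> Hom X T A" for T u v
  proof -
    have T: "T \<in> Obj X" using Hom_Obj[OF u] by simp_all
    have in_A: "fn u t \<in> \<langle>A\<rangle>" "fn v t \<in> \<langle>A\<rangle>" if "t \<in> \<langle>T\<rangle>" for t
      using fn_in[OF u that] fn_in[OF v that] by simp_all
    have "\<exists>k \<in> Hom X T P. \<forall>t\<in>\<langle>T\<rangle>. fn k t = pr (fn u t, fn v t)"
    proof (rule univ[OF T])
      show "(\<lambda>t. pr (fn u t, fn v t)) \<in> \<langle>T\<rangle> \<rightarrow> S" using in_A by (auto simp: S_def)
      show "\<exists>g\<in>Hom X T B. \<forall>t\<in>\<langle>T\<rangle>. fn g t = \<phi> (pr (fn u t, fn v t))" if b: "(B, \<phi>) \<in> ?src" for B \<phi>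
      proof -
        from b consider "B = A" "\<phi> = (\<lambda>z. fst (\<pi> z))" | "B = A" "\<phi> = (\<lambda>z. snd (\<pi> z))" by auto
        then show ?thesis
        proof cases
          case 1 then show ?thesis using in_A by (intro bexI[of _ u]) (simp_all add: \<pi> u)
        next
          case 2 then show ?thesis using in_A by (intro bexI[of _ v]) (simp_all add: \<pi> v)
        qed
      qed
    qed
    then obtain k where k: "k \<in> Hom X T P" "\<And>t. t \<in> \<langle>T\<rangle> \<Longrightarrow> fn k t = pr (fn u t, fn v t)" by blast
    show ?thesis
    proof (rule ex1I[of _ k])
      have "p \<cdot> k = u"
        by (rule faithful[OF Comp_Hom[OF k(1) p(1)] u])
          (use k p in_A \<pi> in \<open>auto simp: fn_comp[OF k(1) p(1)] S_def\<close>)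
      moreover have "q \<cdot> k = v"
        by (rule faithful[OF Comp_Hom[OF k(1) q(1)] v])
          (use k q in_A \<pi> in \<open>auto simp: fn_comp[OF k(1) q(1)] S_def\<close>)
      ultimately show "k \<in> Hom X T P \<and> p \<cdot> k = u \<and> q \<cdot> k = v" using k by blast
    next
      fix k' assume k': "k' \<in> Hom X T P \<and> p \<cdot> k' = u \<and> q \<cdot> k' = v"
      then have k'T: "k' \<in> Hom X T P" by blast
      show "k' = k"
      proof (rule faithful[OF k'T k(1)])
        fix t assume t: "t \<in> \<langle>T\<rangle>"
        have z: "fn k' t \<in> S" using fn_in[OF k'T t] P by simp
        then obtain a b where ab: "fn k' t = pr (a, b)" "a \<in> \<langle>A\<rangle>" "b \<in> \<langle>A\<rangle>" by (auto simp: S_def)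
        have "fn u t = a" "fn v t = b"
          using fn_comp[OF k'T p(1) t] fn_comp[OF k'T q(1) t] k' p(2)[OF z] q(2)[OF z] ab \<pi> by auto
        then show "fn k' t = fn k t" using k(2)[OF t] ab by simp
      qed
    qed
  qed
  then have "is_product X A A p q" using p(1) q(1) unfolding is_product_def by blast
  then show thesis by (rule that)
qed

lemma equalizer:
  assumes f: "f \<in> Hom X A B" and g: "g \<in> Hom X A B"
  obtains m where "is_equalizer X f g m"
proof -
  define S where "S = {a \<in> \<langle>A\<rangle>. fn f a = fn g a}"
  have A: "A \<in> Obj X" using Hom_Obj[OF f] by simp_all
  have "S \<in> U" by (rule universe_subset[OF universe pts_U[OF A]]) (auto simp: S_def)
  then obtain R where R: "R \<in> Obj X" "\<langle>R\<rangle> = S"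
    and incl: "\<And>B \<phi>. (B, \<phi>) \<in> {(A, \<lambda>a. a)} \<Longrightarrow> \<exists>f \<in> Hom X R B. \<forall>x\<in>S. fn f x = \<phi> x"
    and univ: "\<And>T h. T \<in> Obj X \<Longrightarrow> h \<in> \<langle>T\<rangle> \<rightarrow> S
      \<Longrightarrow> (\<And>B \<phi>. (B, \<phi>) \<in> {(A, \<lambda>a. a)} \<Longrightarrow> \<exists>g \<in> Hom X T B. \<forall>t\<in>\<langle>T\<rangle>. fn g t = \<phi> (h t))
      \<Longrightarrow> \<exists>k \<in> Hom X T R. \<forall>t\<in>\<langle>T\<rangle>. fn k t = h t"
    by (rule initial_lift[of S "{(A, \<lambda>a. a)}"]) (use A in \<open>auto simp: S_def\<close>)
  obtain m where m: "m \<in> Hom X R A" "\<And>x. x \<in> S \<Longrightarrow> fn m x = x" using incl[of A "\<lambda>a. a"] by auto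
  have eq: "f \<cdot> m = g \<cdot> m"
    by (rule faithful[OF Comp_Hom[OF m(1) f] Comp_Hom[OF m(1) g]])
      (use m R in \<open>auto simp: fn_comp[OF m(1) f] fn_comp[OF m(1) g] S_def\<close>)
  have "\<exists>!k. k \<in> Hom X T R \<and> m \<cdot> k = u" if u: "u \<in> Hom X T A" and fu: "f \<cdot> u = g \<cdot> u" for T u
  proof -
    have T: "T \<in> Obj X" using Hom_Obj[OF u] by simp_all
    have "fn u t \<in> S" if t: "t \<in> \<langle>T\<rangle>" for t
      using fn_in[OF u t] fn_comp[OF u f t] fn_comp[OF u g t] fu by (simp add: S_def)
    then obtain k where k: "k \<in> Hom X T R" "\<And>t. t \<in> \<langle>T\<rangle> \<Longrightarrow> fn k t = fn u t"
      using univ[OF T, of "fn u"] u by auto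
    show ?thesis
    proof (rule ex1I[of _ k])
      show "k \<in> Hom X T R \<and> m \<cdot> k = u"
      proof
        show "m \<cdot> k = u"
        proof (rule faithful[OF Comp_Hom[OF k(1) m(1)] u])
          fix t assume t: "t \<in> \<langle>T\<rangle>"
          then have "fn k t \<in> S" using fn_in[OF k(1) t] R by simp
          then show "fn (m \<cdot> k) t = fn u t" using fn_comp[OF k(1) m(1) t] k(2)[OF t] m(2) by simp
        qed
      qed (fact k(1))
    next
      fix k' assume k': "k' \<in> Hom X T R \<and> m \<cdot> k' = u"
      then have k'T: "k' \<in> Hom X T R" by blast
      show "k' = k"
      proof (rule faithful[OF k'T k(1)])
        fix t assume t: "t \<in> \<langle>T\<rangle>"
        then have "fn k' t \<in> S" using fn_in[OF k'T t] R by simp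
        then show "fn k' t = fn k t" using fn_comp[OF k'T m(1) t] k(2)[OF t] m(2) k' by simp
      qed
    qed
  qed
  moreover have "f \<in> Arr X" "g \<in> Arr X" "Dom X f = A" "Dom X g = A" "Cod X f = B" "Cod X g = B"
    using f g HomD by metis+
  ultimately have "is_equalizer X f g m" using m(1) eq
    unfolding is_equalizer_def by (intro conjI exI[of _ R]) auto
  then show thesis by (rule that)
qed

lemma pullback_RegMono:
  assumes f: "f \<in> Hom X A B" and g: "g \<in> Hom X A B"
  obtains p q m where "is_product X A A p q" "m \<in> RegMono X" "m \<in> Hom X (Dom X m) (Dom X p)"
    "is_pullback X f g (p \<cdot> m) (q \<cdot> m)"
proof -
  have A: "A \<in> Obj X" using Hom_Obj[OF f] by simp
  obtain p q where pq: "is_product X A A p q" using self_product[OF A] .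
  then obtain P where P: "p \<in> Hom X P A" "q \<in> Hom X P A" unfolding is_product_def by blast
  obtain m where m: "is_equalizer X (f \<cdot> p) (g \<cdot> q) m"
    using equalizer[OF Comp_Hom[OF P(1) f] Comp_Hom[OF P(2) g]] .
  have "Dom X (f \<cdot> p) = Dom X p" using HomD[OF Comp_Hom[OF P(1) f]] HomD[OF P(1)] by simp
  then have "m \<in> Hom X (Dom X m) (Dom X p)" using m HomD unfolding is_equalizer_def by metis
  moreover have "m \<in> RegMono X" using m unfolding RegMono_def by blast
  ultimately show thesis using that pq pullback_from_equalizer[OF f g pq m] by blast
qed

text \<open>
  The kernel pair is built from a product and an equalizer, so that the pairing is a regular
  monomorphism by construction.
\<close>

lemma kernel_pair_PER:
  assumes f: "f \<in> Arr X"
  obtains r1 r2 where "is_kernel_pair X f r1 r2" "(r1, r2) \<in> PER_obj X (RegMono X)"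
proof -
  obtain p q m where pq: "is_product X (Dom X f) (Dom X f) p q" and m: "m \<in> RegMono X"
    "m \<in> Hom X (Dom X m) (Dom X p)" and k: "is_pullback X f f (p \<cdot> m) (q \<cdot> m)"
    using pullback_RegMono[OF HomI[OF f] HomI[OF f]] .
  have k: "is_kernel_pair X f (p \<cdot> m) (q \<cdot> m)" using k by (simp add: is_kernel_pair_def)
  have "p \<in> Hom X (Dom X p) (Dom X f)" using pq unfolding is_product_def by (auto simp: Hom_def)
  then have "p \<cdot> m \<in> Hom X (Dom X m) (Dom X f)" using Comp_Hom m by blast
  then have "Dom X (p \<cdot> m) = Dom X m" "Cod X (p \<cdot> m) = Dom X f" using HomD by metis+
  then have "(p \<cdot> m, q \<cdot> m) \<in> PER_obj X (RegMono X)"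
    using kernel_pair_pseudo_equiv_rel[OF k] pq m unfolding PER_obj_def by auto
  then show thesis using that k by blast
qed

subsection \<open>Relations that are kernel pairs\<close>

definition point_rel :: "'a \<Rightarrow> 'a \<Rightarrow> ('u \<times> 'u) set" where
  "point_rel r1 r2 = (\<lambda>w. (fn r1 w, fn r2 w)) ` \<langle>Dom X r1\<rangle>"

lemma point_relI: "w \<in> \<langle>Dom X r1\<rangle> \<Longrightarrow> (fn r1 w, fn r2 w) \<in> point_rel r1 r2"
  by (simp add: point_rel_def)

text \<open>
  Only transitivity needs more than evaluating the structure maps at points: two points \<open>w\<close>, \<open>w'\<close>
  with \<open>fn r2 w = fn r1 w'\<close> have to come from a point of the pullback.  Represented by arrows out of a
  discrete point, they do so by the universal property.
\<close>

lemma equiv_point_rel: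
  assumes R: "pseudo_equiv_rel X (r1, r2)"
  shows "equiv \<langle>Cod X r1\<rangle> (point_rel r1 r2)"
proof -
  let ?A = "Cod X r1" and ?R = "Dom X r1"
  have r1: "r1 \<in> Hom X ?R ?A" and r2: "r2 \<in> Hom X ?R ?A"
    and refl: "\<exists>r \<in> Hom X ?A ?R. r1 \<cdot> r = Id X ?A \<and> r2 \<cdot> r = Id X ?A"
    and sym: "\<exists>s \<in> Hom X ?R ?R. r1 \<cdot> s = r2 \<and> r2 \<cdot> s = r1"
    and trans: "\<And>r3 r4. is_pullback X r2 r1 r3 r4 \<Longrightarrow>
          (\<exists>t \<in> Hom X (Dom X r3) ?R. r1 \<cdot> t = r1 \<cdot> r3 \<and> r2 \<cdot> t = r2 \<cdot> r4)"
    using R unfolding pseudo_equiv_rel_def by (auto simp: Hom_def)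
  have A: "?A \<in> Obj X" and RO: "?R \<in> Obj X" using Hom_Obj[OF r1] by simp_all
  show ?thesis
  proof (rule equivI)
    show "point_rel r1 r2 \<subseteq> \<langle>?A\<rangle> \<times> \<langle>?A\<rangle>" using fn_in[OF r1] fn_in[OF r2] by (auto simp: point_rel_def)
    obtain r where r: "r \<in> Hom X ?A ?R" "r1 \<cdot> r = Id X ?A" "r2 \<cdot> r = Id X ?A" using refl by blast
    show "refl_on \<langle>?A\<rangle> (point_rel r1 r2)"
    proof (rule refl_onI)
      fix a assume a: "a \<in> \<langle>?A\<rangle>"
      have "fn (Id X ?A) a = a"
        using functor_F A a unfolding is_functor_def by (simp add: fn_def Set_cat_def)
      then have "(fn r1 (fn r a), fn r2 (fn r a)) = (a, a)"
        using fn_comp[OF r(1) r1 a] fn_comp[OF r(1) r2 a] r by simp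
      then show "(a, a) \<in> point_rel r1 r2" using point_relI[OF fn_in[OF r(1) a], of r2] by simp
    qed
    obtain s where s: "s \<in> Hom X ?R ?R" "r1 \<cdot> s = r2" "r2 \<cdot> s = r1" using sym by blast
    show "sym (point_rel r1 r2)"
    proof (rule symI)
      fix a b assume "(a, b) \<in> point_rel r1 r2"
      then obtain w where w: "w \<in> \<langle>?R\<rangle>" "a = fn r1 w" "b = fn r2 w" by (auto simp: point_rel_def)
      then have "(b, a) = (fn r1 (fn s w), fn r2 (fn s w))"
        using fn_comp[OF s(1) r1] fn_comp[OF s(1) r2] s by simp
      then show "(b, a) \<in> point_rel r1 r2" using point_relI[OF fn_in[OF s(1) w(1)], of r2] by simp
    qed
    show "trans (point_rel r1 r2)"
    proof (rule transI)
      fix a b c assume "(a, b) \<in> point_rel r1 r2" "(b, c) \<in> point_rel r1 r2"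
      then obtain w w' where w: "w \<in> \<langle>?R\<rangle>" "a = fn r1 w" "b = fn r2 w"
        and w': "w' \<in> \<langle>?R\<rangle>" "b = fn r1 w'" "c = fn r2 w'" by (auto simp: point_rel_def)
      obtain r3 r4 where pb: "is_pullback X r2 r1 r3 r4" using pullback_RegMono[OF r2 r1] .
      obtain P where P: "r3 \<in> Hom X P ?R" "r4 \<in> Hom X P ?R"
        and univ: "\<And>T u v. u \<in> Hom X T ?R \<Longrightarrow> v \<in> Hom X T ?R \<Longrightarrow> r2 \<cdot> u = r1 \<cdot> v \<Longrightarrow>
          \<exists>k. k \<in> Hom X T P \<and> r3 \<cdot> k = u \<and> r4 \<cdot> k = v"
        using pb r2 r1 by (rule pullbackE) (rule that; assumption)
      obtain t where t: "t \<in> Hom X P ?R" "r1 \<cdot> t = r1 \<cdot> r3" "r2 \<cdot> t = r2 \<cdot> r4"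
        using trans[OF pb] HomD[OF P(1)] by auto
      obtain D \<o> where D: "\<langle>D\<rangle> = {\<o>}"
        "\<And>B x. B \<in> Obj X \<Longrightarrow> x \<in> \<langle>B\<rangle> \<Longrightarrow> \<exists>d \<in> Hom X D B. fn d \<o> = x" by (rule discrete_point) (rule that; assumption)
      have \<o>: "\<o> \<in> \<langle>D\<rangle>" using D by simp
      obtain d where d: "d \<in> Hom X D ?R" "fn d \<o> = w" using D(2)[OF RO w(1)] by blast
      obtain d' where d': "d' \<in> Hom X D ?R" "fn d' \<o> = w'" using D(2)[OF RO w'(1)] by blast
      have "r2 \<cdot> d = r1 \<cdot> d'"
        by (rule faithful[OF Comp_Hom[OF d(1) r2] Comp_Hom[OF d'(1) r1]])
          (use D(1) d d' w w' fn_comp[OF d(1) r2 \<o>] fn_comp[OF d'(1) r1 \<o>] in auto)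
      then obtain e where e: "e \<in> Hom X D P" "r3 \<cdot> e = d" "r4 \<cdot> e = d'" using univ[OF d(1) d'(1)] by blast
      let ?z = "fn e \<o>"
      have z: "?z \<in> \<langle>P\<rangle>" using fn_in[OF e(1) \<o>] .
      have "fn r3 ?z = w" "fn r4 ?z = w'" using fn_comp[OF e(1) _ \<o>] P e d d' by metis+
      then have "(fn r1 (fn t ?z), fn r2 (fn t ?z)) = (a, c)"
        using fn_comp[OF t(1) r1 z] fn_comp[OF t(1) r2 z] fn_comp[OF P(1) r1 z] fn_comp[OF P(2) r2 z] t w w'
        by simp
      then show "(a, c) \<in> point_rel r1 r2" using point_relI[OF fn_in[OF t(1) z], of r2] by simp
    qed
  qed
qed

text \<open>
  Points are arrows out of a discrete point, and arrows into a product are determined by their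
  projections.
\<close>

lemma product_points:
  assumes pq: "is_product X A B p q" and zz: "z \<in> \<langle>Dom X p\<rangle>" "z' \<in> \<langle>Dom X p\<rangle>"
    and eq: "fn p z = fn p z'" "fn q z = fn q z'"
  shows "z = z'"
proof -
  obtain P where p: "p \<in> Hom X P A" and q: "q \<in> Hom X P B"
    and univ: "\<And>T u v. u \<in> Hom X T A \<Longrightarrow> v \<in> Hom X T B \<Longrightarrow> \<exists>!k. k \<in> Hom X T P \<and> p \<cdot> k = u \<and> q \<cdot> k = v"
    using pq unfolding is_product_def by blast
  have P: "P \<in> Obj X" "Dom X p = P" using Hom_Obj[OF p] HomD[OF p] by auto
  obtain D \<o> where D: "\<langle>D\<rangle> = {\<o>}"
    "\<And>B x. B \<in> Obj X \<Longrightarrow> x \<in> \<langle>B\<rangle> \<Longrightarrow> \<exists>d \<in> Hom X D B. fn d \<o> = x" by (rule discrete_point) (rule that; assumption)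
  have \<o>: "\<o> \<in> \<langle>D\<rangle>" using D by simp
  obtain d where d: "d \<in> Hom X D P" "fn d \<o> = z" using D(2)[OF P(1)] zz P by metis
  obtain d' where d': "d' \<in> Hom X D P" "fn d' \<o> = z'" using D(2)[OF P(1)] zz P by metis
  have "p \<cdot> d = p \<cdot> d'"
    by (rule faithful[OF Comp_Hom[OF d(1) p] Comp_Hom[OF d'(1) p]])
      (use D(1) d d' eq fn_comp[OF d(1) p \<o>] fn_comp[OF d'(1) p \<o>] in auto)
  moreover have "q \<cdot> d = q \<cdot> d'"
    by (rule faithful[OF Comp_Hom[OF d(1) q] Comp_Hom[OF d'(1) q]])
      (use D(1) d d' eq fn_comp[OF d(1) q \<o>] fn_comp[OF d'(1) q \<o>] in auto)
  ultimately have "d = d'" using univ[OF Comp_Hom[OF d(1) p] Comp_Hom[OF d(1) q]] d(1) d'(1) by metis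
  then show ?thesis using d d' by simp
qed

text \<open>
  The initial lifting of the empty source.
\<close>

lemma indiscrete:
  assumes "S \<in> U"
  obtains Y where "Y \<in> Obj X" "\<langle>Y\<rangle> = S"
    "\<And>T h. T \<in> Obj X \<Longrightarrow> h \<in> \<langle>T\<rangle> \<rightarrow> S \<Longrightarrow> \<exists>k \<in> Hom X T Y. \<forall>t\<in>\<langle>T\<rangle>. fn k t = h t"
  by (rule initial_lift[OF assms, of "{}"]) auto

text \<open>
  The quotient map is realized without forming a quotient set, by choosing a representative
  in every class.  Its codomain is indiscrete so that the function is a morphism and its kernel
  pair is determined by the equivalence relation on points.
\<close>

lemma PER_is_kernel_pair:
  assumes R: "(r1, r2) \<in> PER_obj X (RegMono X)"
  obtains f where "f \<in> Arr X" "is_kernel_pair X f r1 r2"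
proof -
  let ?A = "Cod X r1" and ?R = "Dom X r1"
  obtain p q m where per: "pseudo_equiv_rel X (r1, r2)" and pq: "is_product X ?A ?A p q"
    and m: "m \<in> Hom X ?R (Dom X p)" "p \<cdot> m = r1" "q \<cdot> m = r2" "m \<in> RegMono X"
    using R unfolding PER_obj_def by auto
  have r1: "r1 \<in> Hom X ?R ?A" and r2: "r2 \<in> Hom X ?R ?A"
    using per unfolding pseudo_equiv_rel_def by (auto simp: Hom_def)
  have A: "?A \<in> Obj X" using Hom_Obj[OF r1] by simp_all
  let ?rel = "point_rel r1 r2"
  have eqv: "equiv \<langle>?A\<rangle> ?rel" by (rule equiv_point_rel[OF per])
  \<comment> \<open>The choice depends on the class of \<open>a\<close> only, so equivalent points get the same representative.\<close>
  define rep where "rep a = (SOME b. b \<in> ?rel `` {a})" for a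
  have rep: "(a, rep a) \<in> ?rel" if "a \<in> \<langle>?A\<rangle>" for a
  proof -
    have "a \<in> ?rel `` {a}" using equiv_class_self[OF eqv that] .
    then have "rep a \<in> ?rel `` {a}" unfolding rep_def by (rule someI)
    then show ?thesis by simp
  qed
  have rep_in: "rep \<in> \<langle>?A\<rangle> \<rightarrow> \<langle>?A\<rangle>" using rep equiv_type[OF eqv] by blast
  have rep_eq: "rep a = rep b \<longleftrightarrow> (a, b) \<in> ?rel" if "a \<in> \<langle>?A\<rangle>" "b \<in> \<langle>?A\<rangle>" for a b
  proof
    assume "rep a = rep b"
    then have "(a, rep b) \<in> ?rel" using rep[OF that(1)] by simp
    moreover have "(rep b, b) \<in> ?rel" using rep[OF that(2)] eqv by (meson equiv_def symD)
    ultimately show "(a, b) \<in> ?rel" using eqv by (meson equiv_def transD)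
  next
    assume "(a, b) \<in> ?rel"
    then show "rep a = rep b" using equiv_class_eq[OF eqv] by (simp add: rep_def)
  qed
  obtain Y where Y: "Y \<in> Obj X" "\<langle>Y\<rangle> = \<langle>?A\<rangle>"
    and indisc: "\<And>T h. T \<in> Obj X \<Longrightarrow> h \<in> \<langle>T\<rangle> \<rightarrow> \<langle>?A\<rangle> \<Longrightarrow> \<exists>k \<in> Hom X T Y. \<forall>t\<in>\<langle>T\<rangle>. fn k t = h t"
    using indiscrete[OF pts_U[OF A]] by blast
  obtain f where f: "f \<in> Hom X ?A Y" "\<And>a. a \<in> \<langle>?A\<rangle> \<Longrightarrow> fn f a = rep a" using indisc[OF A rep_in] by blast
  obtain P where p: "p \<in> Hom X P ?A" and q: "q \<in> Hom X P ?A"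
    and univ: "\<And>T u v. u \<in> Hom X T ?A \<Longrightarrow> v \<in> Hom X T ?A \<Longrightarrow> \<exists>!k. k \<in> Hom X T P \<and> p \<cdot> k = u \<and> q \<cdot> k = v"
    using pq unfolding is_product_def by blast
  have domp: "Dom X p = P" using HomD[OF p] by simp
  note m = m[unfolded domp]
  obtain a b where "is_equalizer X a b m" using m(4) unfolding RegMono_def by blast
  then obtain Z where ab: "a \<in> Hom X P Z" "b \<in> Hom X P Z" "a \<cdot> m = b \<cdot> m"
    and euniv: "\<And>T u. u \<in> Hom X T P \<Longrightarrow> a \<cdot> u = b \<cdot> u \<Longrightarrow> \<exists>!k. k \<in> Hom X T ?R \<and> m \<cdot> k = u"
    using HomD[OF m(1)] unfolding is_equalizer_def by (auto simp: Hom_def)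
  have "\<exists>!k. k \<in> Hom X T ?R \<and> r1 \<cdot> k = u \<and> r2 \<cdot> k = v"
    if u: "u \<in> Hom X T ?A" and v: "v \<in> Hom X T ?A" and fuv: "f \<cdot> u = f \<cdot> v" for T u v
  proof -
    obtain d where d: "d \<in> Hom X T P" "p \<cdot> d = u" "q \<cdot> d = v" using univ[OF u v] by blast
    have "a \<cdot> d = b \<cdot> d"
    proof (rule faithful[OF Comp_Hom[OF d(1) ab(1)] Comp_Hom[OF d(1) ab(2)]])
      fix t assume t: "t \<in> \<langle>T\<rangle>"
      have in_A: "fn u t \<in> \<langle>?A\<rangle>" "fn v t \<in> \<langle>?A\<rangle>" using fn_in[OF u t] fn_in[OF v t] by simp_all
      have "rep (fn u t) = rep (fn v t)"
        using fn_comp[OF u f(1) t] fn_comp[OF v f(1) t] fuv f(2) in_A by simp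
      then have "(fn u t, fn v t) \<in> ?rel" using rep_eq in_A by blast
      then obtain w where w: "w \<in> \<langle>?R\<rangle>" "fn u t = fn r1 w" "fn v t = fn r2 w" by (auto simp: point_rel_def)
      \<comment> \<open>The point \<open>fn d t\<close> of the product lies in the image of the regular monomorphism.\<close>
      have "fn d t = fn m w"
      proof (rule product_points[OF pq])
        show "fn d t \<in> \<langle>Dom X p\<rangle>" "fn m w \<in> \<langle>Dom X p\<rangle>"
          using fn_in[OF d(1) t] fn_in[OF m(1) w(1)] domp by simp_all
        show "fn p (fn d t) = fn p (fn m w)"
          using fn_comp[OF d(1) p t] fn_comp[OF m(1) p w(1)] d m w by simp
        show "fn q (fn d t) = fn q (fn m w)"
          using fn_comp[OF d(1) q t] fn_comp[OF m(1) q w(1)] d m w by simp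
      qed
      then show "fn (a \<cdot> d) t = fn (b \<cdot> d) t"
        using fn_comp[OF d(1) ab(1) t] fn_comp[OF d(1) ab(2) t]
          fn_comp[OF m(1) ab(1) w(1)] fn_comp[OF m(1) ab(2) w(1)] ab(3) by simp
    qed
    then obtain k where k: "k \<in> Hom X T ?R" "m \<cdot> k = d"
      and k_unique: "\<And>k'. k' \<in> Hom X T ?R \<Longrightarrow> m \<cdot> k' = d \<Longrightarrow> k' = k" using euniv[OF d(1)] by blast
    have legs: "r1 \<cdot> k' = p \<cdot> m \<cdot> k'" "r2 \<cdot> k' = q \<cdot> m \<cdot> k'" if "k' \<in> Hom X T ?R" for k'
      using Comp_assoc[OF that m(1) p] Comp_assoc[OF that m(1) q] m(2,3) by simp_all
    show ?thesis
    proof (rule ex1I[of _ k])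
      show "k \<in> Hom X T ?R \<and> r1 \<cdot> k = u \<and> r2 \<cdot> k = v" using k d legs by simp
      fix k' assume k': "k' \<in> Hom X T ?R \<and> r1 \<cdot> k' = u \<and> r2 \<cdot> k' = v"
      then have "m \<cdot> k' \<in> Hom X T P" "p \<cdot> m \<cdot> k' = u" "q \<cdot> m \<cdot> k' = v"
        using Comp_Hom m(1) legs by auto
      then have "m \<cdot> k' = d" using univ[OF u v] d by blast
      then show "k' = k" using k_unique k' by blast
    qed
  qed
  moreover have "f \<cdot> r1 = f \<cdot> r2"
  proof (rule faithful[OF Comp_Hom[OF r1 f(1)] Comp_Hom[OF r2 f(1)]])
    fix w assume w: "w \<in> \<langle>?R\<rangle>"
    then have "(fn r1 w, fn r2 w) \<in> ?rel" by (rule point_relI)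
    then show "fn (f \<cdot> r1) w = fn (f \<cdot> r2) w"
      using rep_eq f(2) fn_in[OF r1 w] fn_in[OF r2 w] fn_comp[OF r1 f(1) w] fn_comp[OF r2 f(1) w] by simp
  qed
  moreover have "f \<in> Arr X" "Dom X f = ?A" using HomD[OF f(1)] by auto
  ultimately have "is_kernel_pair X f r1 r2"
    using r1 r2 unfolding is_kernel_pair_def is_pullback_def by (intro conjI exI[of _ ?R]) auto
  then show thesis using that \<open>f \<in> Arr X\<close> by blast
qed

theorem regular_completion_equivalent_PER:
  "equivalent_categories (regular_completion X) (PER X (RegMono X))"
proof -
  interpret reg: hom_congruence X "Arr X" "Dom X" "reg_hom X" "reg_rel X"
    by (rule reg_hom_congruence) (metis kernel_pair_PER)
  show ?thesis unfolding regular_completion_def PER_def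
  proof (rule reg.equivalent_categories_relabel[where k = "\<lambda>f (r1, r2). is_kernel_pair X f r1 r2"])
    fix f assume "f \<in> Arr X"
    then show "\<exists>r\<in>PER_obj X (RegMono X). case r of (r1, r2) \<Rightarrow> is_kernel_pair X f r1 r2"
      using kernel_pair_PER by (metis case_prod_conv)
  next
    fix r assume "r \<in> PER_obj X (RegMono X)"
    then show "\<exists>f\<in>Arr X. case r of (r1, r2) \<Rightarrow> is_kernel_pair X f r1 r2"
      using PER_is_kernel_pair by (metis case_prod_conv surj_pair)
  next
    fix f g r s
    assume "case r of (r1, r2) \<Rightarrow> is_kernel_pair X f r1 r2" "case s of (s1, s2) \<Rightarrow> is_kernel_pair X g s1 s2"
    then obtain r1 r2 s1 s2 where rs: "r = (r1, r2)" "s = (s1, s2)"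
      and k: "is_kernel_pair X f r1 r2" "is_kernel_pair X g s1 s2" by (cases r; cases s) auto
    have "r1 \<in> Hom X (Dom X r1) (Dom X f)" using k(1) by (rule kernel_pairE; blast)
    then have "Cod X r1 = Dom X f" using HomD by metis
    then show "(case r of (r1, r2) \<Rightarrow> Cod X r1) = Dom X f \<and> PER_hom X r s = reg_hom X f g
        \<and> PER_rel X r s = reg_rel X f g"
      using rs reg_hom_eq_PER_hom[OF k] reg_rel_eq_PER_rel[OF k] by simp
  qed
qed

end

theorem lemma2p2:
  fixes U :: "'u set set"
    and X :: "('o, 'a) cat"
    and F :: "('o, 'a, 'u set, 'u set \<times> ('u \<Rightarrow> 'u) \<times> 'u set) cat_functor"
  assumes "set_universe U"
    and "category X"
    and "topological X (Set_cat U) F"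
  shows "equivalent_categories (regular_completion X) (PER X (RegMono X))"
proof -
  interpret topological_over_sets X U F
    using assms by (simp add: topological_over_sets_def topological_over_sets_axioms_def)
  show ?thesis by (rule regular_completion_equivalent_PER)
qed

end
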